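(* Let $n\ge1$, let $a=v_0<v_1<\dots<v_n=b$, let $\zeta_i\in(v_i,v_{i+1})$ for $0\le i\le n-1$, put $\zeta_{-1}=v_0$, $\zeta_n=v_n$, and let $\varphi(i)\ge 2$ be integers for $0\le i\le n$. For each $0\le i\le n$ and $|\alpha|=\varphi(i)-1$, let $t_{i,\alpha}^{\ell}\in[a,b]$, $\ell=0,\dots,\varphi(i)$, be $\varphi(i)+1$ distinct points in a neighbourhood of $v_i$, and let $L_{i,\alpha}^{j}\in\mathbb{P}_{\varphi(i)}$, $j=0,\dots,\varphi(i)$, be the associated Lagrange basis, i.e. $L_{i,\alpha}^{j}(t_{i,\alpha}^{\ell})=\delta_{j\ell}$. For $f:[a,b]\to\mathbb{R}$ set $$\nu_{i,\alpha}(f)=\sum_{\ell=0}^{\varphi(i)}f\bigl(t_{i,\alpha}^{\ell}\bigr)\,\mathbf{B}\bigl[L_{i,\alpha}^{\ell}\bigr]\bigl(v_i,\zeta_{i-1}[\alpha_1],\zeta_i[\alpha_2]\bigr),$$ where $\mathbf{B}[L_{i,\alpha}^{\ell}]$ is the blossom of $L_{i,\alpha}^\ell$ as a polynomial of degree $\varphi(i)$. Then the operator $$\mathcal{Q}_{\varphi,\overline{\tau}_n}f=\sum_{i=0}^{n}\ \sum_{|\alpha|=\varphi(i)-1}\nu_{i,\alpha}(f)\,\mathcal{N}_{i,\alpha}$$ satisfies $\mathcal{Q}_{\varphi,\overline{\tau}_n}\tilde p=\tilde p$ on $[a,b]$ for all $\tilde p\in\mathbb{P}_{\min_{0\le i\le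 n}\varphi(i)}$.
   Context: $\mathbb{P}_d$ is the space of real polynomials of degree $\le d$. The space $\mathcal{S}^1(\varphi,\overline{\tau}_n)$ consists of all functions $s:[a,b]\to\mathbb{R}$ such that: (i) for each $0\le i\le n$, the restrictions of $s$ to $[\zeta_{i-1},v_i]$ and to $[v_i,\zeta_i]$ (when non-degenerate) are in $\mathbb{P}_{\varphi(i)}$; (ii) $s$ is $\mathcal{C}^{\varphi(i)-1}$ at $v_i$ for $0<i<n$; (iii) $s$ is $\mathcal{C}^1$ at $\zeta_i$ for $0\le i\le n-1$ ("$\mathcal{C}^r$ at a point" means that the derivatives of orders $0,\dots,r$ of the two adjacent polynomial pieces agree there). A function $s\in\mathcal{S}^1(\varphi,\overline{\tau}_n)$ exists and is unique with arbitrarily prescribed values $s^{(j)}(v_i)$, $0\le i\le n$, $0\le j\le\varphi(i)-1$ (one-sided derivatives at $a$, $b$). For $p\in\mathbb{P}_d$, the blossom $\mathbf{B}[p]:\mathbb{R}^d\to\mathbb{R}$ (of $p$ as a polynomial of degree $d$) is the unique symmetric function, affine in each argument, with $\mathbf{B}[p](v,\dots,v)=p(v)$. The notation $v[\ell]$ means that the argument $v$ is repeated $\ell$ times. For a multi-index $\alpha=(\alpha_1,\alpha_2)\in\mathbb{Z}_{\ge0}^2$ with $|\alpha|=\alpha_1+\alpha_2=d$ and an interval $[A,B]$, the Bernstein polynomial is $\mathfrak{B}^d_{\alpha,[A,B]}(v)=\frac{d!}{\alpha_1!\alpha_2!}\frac{(B-v)^{\alpha_1}(v-A)^{\alpha_2}}{(B-A)^d}$.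 For $0\le i\le n$ let $\theta_i=\frac{\varphi(i)-1}{\varphi(i)}$, $S_{i,1}=\theta_i\zeta_{i-1}+(1-\theta_i)v_i$, $S_{i,2}=\theta_i\zeta_i+(1-\theta_i)v_i$, and $S_i=[S_{i,1},S_{i,2}]$ (so $S_{0,1}=v_0$ and $S_{n,2}=v_n$). For $|\alpha|=\varphi(i)-1$ and $0\le j\le\varphi(i)-1$ set $$\gamma_{i,\alpha}^j=\frac{\binom{\varphi(i)}{j}}{\binom{\varphi(i)-1}{j}}\,\theta_i^j\,\bigl(\mathfrak{B}^{\varphi(i)-1}_{\alpha,S_i}\bigr)^{(j)}(v_i).$$ The B-spline-like function $\mathcal{N}_{i,\alpha}$ is the unique element of $\mathcal{S}^1(\varphi,\overline{\tau}_n)$ with $\mathcal{N}_{i,\alpha}^{(j)}(v_i)=\gamma_{i,\alpha}^j$ for $0\le j\le\varphi(i)-1$ and $\mathcal{N}_{i,\alpha}^{(j)}(v_k)=0$ for $k\ne i$, $0\le j\le\varphi(k)-1$. The phrase "in a neighbourhood of $v_i$" only indicates locality and imposes no quantitative restriction. *)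

theory Defs
  imports "HOL-Analysis.Analysis" "HOL-Library.Multiset" "HOL-Library.FuncSet"
    "HOL-Computational_Algebra.Polynomial"
begin

text \<open>Points of \<open>\<real>\<^sup>d\<close> are lists of length \<open>d\<close>, so that \<open>d\<close> may vary within a statement.\<close>

definition is_blossom :: "nat \<Rightarrow> real poly \<Rightarrow> (real list \<Rightarrow> real) \<Rightarrow> bool" where
  "is_blossom d p B \<longleftrightarrow>
     (\<forall>xs ys. length xs = d \<longrightarrow> mset xs = mset ys \<longrightarrow> B xs = B ys) \<and>
     (\<forall>xs k. length xs = d \<longrightarrow> k < d \<longrightarrow> (\<exists>m c. \<forall>x. B (xs[k := x]) = m * x + c)) \<and>
     (\<forall>x. B (replicate d x) = poly p x)"

text \<open>The extensionality condition fixes the value on lists of other lengths, which is needed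
  for the description to be unique; likewise for splines outside \<open>[a, b]\<close> below.\<close>

definition blossom :: "nat \<Rightarrow> real poly \<Rightarrow> real list \<Rightarrow> real" where
  "blossom d p = (THE B. B \<in> extensional {xs. length xs = d} \<and> is_blossom d p B)"

definition multi_indices :: "nat \<Rightarrow> (nat \<times> nat) set" where
  "multi_indices d = {\<alpha>. fst \<alpha> + snd \<alpha> = d}"

definition bernstein :: "nat \<Rightarrow> nat \<times> nat \<Rightarrow> real \<Rightarrow> real \<Rightarrow> real \<Rightarrow> real" where
  "bernstein d \<alpha> A B x =
     fact d / (fact (fst \<alpha>) * fact (snd \<alpha>)) *
     ((B - x) ^ fst \<alpha> * (x - A) ^ snd \<alpha> / (B - A) ^ d)"

text \<open>Iterated derivative of a function on \<open>[a, b]\<close>, one-sided at the end points.\<close>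

definition nth_deriv_on :: "real \<Rightarrow> real \<Rightarrow> nat \<Rightarrow> (real \<Rightarrow> real) \<Rightarrow> real \<Rightarrow> real" where
  "nth_deriv_on a b j = (\<lambda>g x. vector_derivative g (at x within {a..b})) ^^ j"

text \<open>\<open>C\<^sup>r\<close> contact of two polynomial pieces at a point.\<close>

definition joins :: "nat \<Rightarrow> real poly \<Rightarrow> real poly \<Rightarrow> real \<Rightarrow> bool" where
  "joins r p q x \<longleftrightarrow> (\<forall>k\<le>r. poly ((pderiv ^^ k) p) x = poly ((pderiv ^^ k) q) x)"

text \<open>\<open>\<zeta>\<close> is indexed by integers because the index \<open>-1\<close> occurs. The pieces on
  \<open>[\<zeta>\<^sub>i\<^sub>-\<^sub>1, v\<^sub>i]\<close> and \<open>[v\<^sub>i, \<zeta>\<^sub>i]\<close> are \<open>l i\<close> and \<open>r i\<close>; they are degenerate for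
  \<open>l 0\<close> and \<open>r n\<close>, which are therefore not constrained.\<close>

definition spline_space ::
  "nat \<Rightarrow> (nat \<Rightarrow> real) \<Rightarrow> (int \<Rightarrow> real) \<Rightarrow> (nat \<Rightarrow> nat) \<Rightarrow> (real \<Rightarrow> real) set" where
  "spline_space n v \<zeta> \<phi> =
     {s. s \<in> extensional {v 0..v n} \<and>
       (\<exists>l r :: nat \<Rightarrow> real poly.
          (\<forall>i. 0 < i \<and> i \<le> n \<longrightarrow>
             degree (l i) \<le> \<phi> i \<and> (\<forall>x\<in>{\<zeta> (int i - 1)..v i}. s x = poly (l i) x)) \<and>
          (\<forall>i<n. degree (r i) \<le> \<phi> i \<and> (\<forall>x\<in>{v i..\<zeta> (int i)}. s x = poly (r i) x)) \<and>
          (\<forall>i. 0 < i \<and> i < n \<longrightarrow> joins (\<phi> i - 1) (l i) (r i) (v i)) \<and>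
          (\<forall>i<n. joins 1 (r i) (l (i + 1)) (\<zeta> (int i))))}"

definition theta :: "(nat \<Rightarrow> nat) \<Rightarrow> nat \<Rightarrow> real" where
  "theta \<phi> i = (real (\<phi> i) - 1) / real (\<phi> i)"

definition S_left :: "(nat \<Rightarrow> real) \<Rightarrow> (int \<Rightarrow> real) \<Rightarrow> (nat \<Rightarrow> nat) \<Rightarrow> nat \<Rightarrow> real" where
  "S_left v \<zeta> \<phi> i = theta \<phi> i * \<zeta> (int i - 1) + (1 - theta \<phi> i) * v i"

definition S_right :: "(nat \<Rightarrow> real) \<Rightarrow> (int \<Rightarrow> real) \<Rightarrow> (nat \<Rightarrow> nat) \<Rightarrow> nat \<Rightarrow> real" where
  "S_right v \<zeta> \<phi> i = theta \<phi> i * \<zeta> (int i) + (1 - theta \<phi> i) * v i"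

definition gam ::
  "(nat \<Rightarrow> real) \<Rightarrow> (int \<Rightarrow> real) \<Rightarrow> (nat \<Rightarrow> nat) \<Rightarrow> nat \<Rightarrow> nat \<times> nat \<Rightarrow> nat \<Rightarrow> real" where
  "gam v \<zeta> \<phi> i \<alpha> j =
     real (\<phi> i choose j) / real ((\<phi> i - 1) choose j) * theta \<phi> i ^ j *
     (deriv ^^ j) (bernstein (\<phi> i - 1) \<alpha> (S_left v \<zeta> \<phi> i) (S_right v \<zeta> \<phi> i)) (v i)"

definition bspline_like ::
  "nat \<Rightarrow> (nat \<Rightarrow> real) \<Rightarrow> (int \<Rightarrow> real) \<Rightarrow> (nat \<Rightarrow> nat) \<Rightarrow> nat \<Rightarrow> nat \<times> nat \<Rightarrow> real \<Rightarrow> real" where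
  "bspline_like n v \<zeta> \<phi> i \<alpha> =
     (THE s. s \<in> spline_space n v \<zeta> \<phi> \<and>
        (\<forall>j\<le>\<phi> i - 1. nth_deriv_on (v 0) (v n) j s (v i) = gam v \<zeta> \<phi> i \<alpha> j) \<and>
        (\<forall>k\<le>n. k \<noteq> i \<longrightarrow> (\<forall>j\<le>\<phi> k - 1. nth_deriv_on (v 0) (v n) j s (v k) = 0)))"

definition nu ::
  "(nat \<Rightarrow> real) \<Rightarrow> (int \<Rightarrow> real) \<Rightarrow> (nat \<Rightarrow> nat) \<Rightarrow> (nat \<Rightarrow> nat \<times> nat \<Rightarrow> nat \<Rightarrow> real) \<Rightarrow>
   (nat \<Rightarrow> nat \<times> nat \<Rightarrow> nat \<Rightarrow> real poly) \<Rightarrow> nat \<Rightarrow> nat \<times> nat \<Rightarrow> (real \<Rightarrow> real) \<Rightarrow> real" where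
  "nu v \<zeta> \<phi> t L i \<alpha> f =
     (\<Sum>k = 0..\<phi> i. f (t i \<alpha> k) *
        blossom (\<phi> i) (L i \<alpha> k)
          (v i # replicate (fst \<alpha>) (\<zeta> (int i - 1)) @ replicate (snd \<alpha>) (\<zeta> (int i))))"

definition quasi_interp ::
  "nat \<Rightarrow> (nat \<Rightarrow> real) \<Rightarrow> (int \<Rightarrow> real) \<Rightarrow> (nat \<Rightarrow> nat) \<Rightarrow> (nat \<Rightarrow> nat \<times> nat \<Rightarrow> nat \<Rightarrow> real) \<Rightarrow>
   (nat \<Rightarrow> nat \<times> nat \<Rightarrow> nat \<Rightarrow> real poly) \<Rightarrow> (real \<Rightarrow> real) \<Rightarrow> real \<Rightarrow> real" where
  "quasi_interp n v \<zeta> \<phi> t L f x =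
     (\<Sum>i = 0..n. \<Sum>\<alpha>\<in>multi_indices (\<phi> i - 1).
        nu v \<zeta> \<phi> t L i \<alpha> f * bspline_like n v \<zeta> \<phi> i \<alpha> x)"

end

theory Submission imports Defs begin

text \<open>Write \<open>d = \<phi> i\<close>. By Lagrange interpolation and linearity of the blossom,
  \<open>\<nu>\<^sub>i\<^sub>,\<^sub>\<alpha>(p) = B[p](v\<^sub>i, \<zeta>\<^sub>i\<^sub>-\<^sub>1[\<alpha>\<^sub>1], \<zeta>\<^sub>i[\<alpha>\<^sub>2])\<close>. These numbers are the Bernstein coefficients on
  \<open>[\<zeta>\<^sub>i\<^sub>-\<^sub>1, \<zeta>\<^sub>i]\<close> of the polynomial \<open>x \<mapsto> B[p](v\<^sub>i, x[d-1]) = p x + (v\<^sub>i - x) p' x / d\<close>, and the numbers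
  \<open>\<gamma>\<close> are scaled so that combining them with these coefficients yields the derivatives
  of \<open>p\<close> at \<open>v\<^sub>i\<close>. Hence the quasi-interpolant and \<open>p\<close> are splines with the same Hermite data at
  all \<open>v\<^sub>i\<close>. Such a spline is unique: a difference has pieces \<open>c (x - v\<^sub>i)\<^sup>\<phi>\<^sup>(\<^sup>i\<^sup>)\<close>, and the \<open>C\<^sup>1\<close>
  conditions at the \<open>\<zeta>\<^sub>i\<close> force \<open>c = 0\<close>.\<close>

section \<open>Blossoms\<close>

definition polar_pairing :: "nat \<Rightarrow> real poly \<Rightarrow> real poly \<Rightarrow> real" where
  "polar_pairing d p G = (\<Sum>k\<le>d. coeff p k * coeff G k / real (d choose k))"

text \<open>The coefficient of index \<open>k\<close> in this product is the \<open>k\<close>-th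
  elementary symmetric polynomial of the arguments. This is the classical rule that the blossom of
  the \<open>k\<close>-th power is that polynomial divided by \<open>d choose k\<close>.\<close>

definition polar_form :: "nat \<Rightarrow> real poly \<Rightarrow> real list \<Rightarrow> real" where
  "polar_form d p xs = polar_pairing d p (\<Prod>x\<leftarrow>xs. [:1, x:])"

lemma polar_pairing_add_right:
  "polar_pairing d p (G + H) = polar_pairing d p G + polar_pairing d p H"
  by (simp add: polar_pairing_def algebra_simps add_divide_distrib sum.distrib)

lemma polar_pairing_smult_right:
  "polar_pairing d p (smult c G) = c * polar_pairing d p G"
  by (simp add: polar_pairing_def sum_distrib_left algebra_simps)

lemma polar_pairing_sum_right:
  "polar_pairing d p (\<Sum>i\<in>I. G i) = (\<Sum>i\<in>I. polar_pairing d p (G i))"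
  by (induction I rule: infinite_finite_induct)
    (simp_all add: polar_pairing_add_right, simp_all add: polar_pairing_def)

lemma polar_pairing_sum_smult_left:
  "polar_pairing d (\<Sum>i\<in>I. smult (c i) (p i)) G = (\<Sum>i\<in>I. c i * polar_pairing d (p i) G)"
  unfolding polar_pairing_def sum_distrib_left
  by (subst sum.swap)
    (simp add: coeff_sum sum_distrib_right sum_distrib_left sum_divide_distrib mult_ac)

lemma poly_eq_sum_atMost:
  fixes p :: "'a :: comm_semiring_1 poly"
  assumes "degree p \<le> d"
  shows "poly p x = (\<Sum>k\<le>d. coeff p k * x ^ k)"
  unfolding poly_altdef using assms
  by (intro sum.mono_neutral_left) (auto simp: coeff_eq_0)

text \<open>The binomial in the \<open>k\<close>-th coefficient of the power cancels the
  normalisation of the pairing.\<close>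

lemma polar_pairing_power:
  assumes "degree p \<le> d"
  shows "polar_pairing d p ([:1, x:] ^ d) = poly p x"
proof -
  have "polar_pairing d p ([:1, x:] ^ d) = (\<Sum>k\<le>d. coeff p k * x ^ k)"
    unfolding polar_pairing_def by (rule sum.cong) (auto simp: coeff_linear_poly_power)
  also have "\<dots> = poly p x"
    by (rule poly_eq_sum_atMost[symmetric, OF assms])
  finally show ?thesis .
qed

text \<open>Permuting arguments permutes commuting factors, each argument enters exactly one linear
  factor, and equal arguments turn the product into a power.\<close>

lemma is_blossom_polar_form:
  assumes "degree p \<le> d"
  shows "is_blossom d p (polar_form d p)"
  unfolding is_blossom_def
proof (intro conjI allI impI)
  fix xs ys :: "real list"
  assume "mset xs = mset ys"
  then have "(\<Prod>x\<in>#mset xs. [:1, x:]) = (\<Prod>x\<in>#mset ys. [:1, x:])" by simp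
  then show "polar_form d p xs = polar_form d p ys"
    unfolding polar_form_def by (simp add: prod_mset_prod_list flip: mset_map)
next
  fix xs :: "real list" and k
  assume k: "length xs = d" "k < d"
  define R where "R = (\<Prod>x\<leftarrow>take k xs @ drop (Suc k) xs. [:1, x:])"
  have "polar_form d p (xs[k := x]) = polar_pairing d p (pCons 0 R) * x + polar_pairing d p R" for x
  proof -
    have "(\<Prod>x\<leftarrow>xs[k := x]. [:1, x:]) = [:1, x:] * R"
      using k by (simp only: upd_conv_take_nth_drop)
        (simp add: R_def map_append algebra_simps del: mult_pCons_left mult_pCons_right)
    also have "\<dots> = smult x (pCons 0 R) + R" by simp
    finally show ?thesis
      by (simp add: polar_form_def polar_pairing_add_right polar_pairing_smult_right
          del: smult_pCons)
  qed
  then show "\<exists>m c. \<forall>x. polar_form d p (xs[k := x]) = m * x + c" by blast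
next
  fix x
  show "polar_form d p (replicate d x) = poly p x"
    using polar_pairing_power[OF assms] by (simp add: polar_form_def prod_list_replicate)
qed

section \<open>Uniqueness of the blossom\<close>

text \<open>The linear coefficient in \<open>u\<close> records the effect of replacing a single diagonal
  argument \<open>x\<close> by \<open>y\<close>; when the diagonal values vanish identically, so does this coefficient.\<close>

lemma symmetric_multiaffine_poly:
  fixes D :: "real list \<Rightarrow> real"
  assumes sym: "\<And>xs ys. length xs = d \<Longrightarrow> mset xs = mset ys \<Longrightarrow> D xs = D ys"
    and aff: "\<And>xs k. length xs = d \<Longrightarrow> k < d \<Longrightarrow> \<exists>m c. \<forall>x. D (xs[k := x]) = m * x + c"
    and "m + length ys = d"
  shows "\<exists>q. (\<forall>u. D (replicate m (x + u * (y - x)) @ ys) = poly q u) \<and>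
    coeff q 1 = real m * (D (y # replicate (m - 1) x @ ys) - D (replicate m x @ ys))"
  using assms(3)
proof (induction m arbitrary: ys)
  case 0
  show ?case by (intro exI[of _ "[:D ys:]"]) simp
next
  case (Suc m)
  let ?z = "\<lambda>u. x + u * (y - x)"
  \<comment> \<open>One of the \<open>Suc m\<close> moving arguments is frozen at either end of the
    segment from \<open>x\<close> to \<open>y\<close>, so that the induction hypothesis applies to
    the other \<open>m\<close>.\<close>
  from Suc obtain q1 where q1: "\<And>u. D (replicate m (?z u) @ x # ys) = poly q1 u"
    "coeff q1 1 = real m * (D (y # replicate (m - 1) x @ x # ys) - D (replicate m x @ x # ys))"
    by (auto dest!: meta_spec[of _ "x # ys"])
  from Suc obtain q2 where q2: "\<And>u. D (replicate m (?z u) @ y # ys) = poly q2 u"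
    by (auto dest!: meta_spec[of _ "y # ys"])
  define q where "q = [:1, -1:] * q1 + [:0, 1:] * q2"
  have "D (replicate (Suc m) (?z u) @ ys) = poly q u" for u
  proof -
    obtain c e where ce: "\<And>w. D (w # replicate m (?z u) @ ys) = c * w + e"
      using aff[of "0 # replicate m (?z u) @ ys" 0] Suc.prems by auto
    have "D (w # replicate m (?z u) @ ys) = D (replicate m (?z u) @ w # ys)" for w
      using Suc.prems by (intro sym) auto
    then have "poly q1 u = c * x + e" "poly q2 u = c * y + e"
      by (metis ce q1(1), metis ce q2)
    then have "poly q u = c * ?z u + e"
      by (simp add: q_def algebra_simps)
    then show ?thesis using ce[of "?z u"] by simp
  qed
  moreover have "coeff q 1 = real (Suc m) *
      (D (y # replicate (Suc m - 1) x @ ys) - D (replicate (Suc m) x @ ys))"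
  proof -
    have x: "D (replicate m x @ x # ys) = D (replicate (Suc m) x @ ys)"
      using Suc.prems by (intro sym) auto
    have y: "D (replicate m x @ y # ys) = D (y # replicate m x @ ys)"
      using Suc.prems by (intro sym) auto
    \<comment> \<open>For \<open>m = 0\<close> the truncated \<open>m - 1\<close> gives lists of
      different lengths, but the factor \<open>real m\<close> is then zero.\<close>
    have xy: "real m * D (y # replicate (m - 1) x @ x # ys) = real m * D (y # replicate m x @ ys)"
    proof (cases m)
      case (Suc k)
      have "D (y # replicate k x @ x # ys) = D (y # replicate (Suc k) x @ ys)"
        using Suc.prems \<open>m = Suc k\<close> by (intro sym) auto
      with Suc show ?thesis by simp
    qed simp
    have "coeff q1 0 = D (replicate (Suc m) x @ ys)" "coeff q2 0 = D (y # replicate m x @ ys)"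
      using q1(1)[of 0] q2(1)[of 0] x y by (auto simp: poly_0_coeff_0)
    then have "coeff q 1 = coeff q1 1 + (D (y # replicate m x @ ys) - D (replicate (Suc m) x @ ys))"
      by (simp add: q_def)
    then show ?thesis using xy x unfolding q1(2) by (simp add: algebra_simps)
  qed
  ultimately show ?case by blast
qed

text \<open>Induction on the arguments \<open>ys\<close> outside the diagonal block. With one entry
  fewer in \<open>ys\<close>, the values along the whole segment from \<open>x\<close> to
  \<open>y\<close> vanish, so the polynomial of the preceding lemma is zero. Its linear coefficient
  then shows that exchanging one \<open>x\<close> for \<open>y\<close> keeps the value zero.\<close>

lemma symmetric_multiaffine_eq_0:
  fixes D :: "real list \<Rightarrow> real"
  assumes sym: "\<And>xs ys. length xs = d \<Longrightarrow> mset xs = mset ys \<Longrightarrow> D xs = D ys"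
    and aff: "\<And>xs k. length xs = d \<Longrightarrow> k < d \<Longrightarrow> \<exists>m c. \<forall>x. D (xs[k := x]) = m * x + c"
    and diag: "\<And>x. D (replicate d x) = 0"
    and "length xs = d"
  shows "D xs = 0"
proof -
  have "m + length ys = d \<Longrightarrow> D (replicate m x @ ys) = 0" for m ys x
  proof (induction ys arbitrary: m x)
    case Nil
    then show ?case using diag by simp
  next
    case (Cons y ys)
    then have len: "Suc m + length ys = d" by simp
    obtain q where q: "\<And>u. D (replicate (Suc m) (x + u * (y - x)) @ ys) = poly q u"
      "coeff q 1 = real (Suc m) * (D (y # replicate (Suc m - 1) x @ ys) - D (replicate (Suc m) x @ ys))"
      using symmetric_multiaffine_poly[OF sym aff len, of x y] by blast
    have "poly q = poly 0" using q(1) Cons.IH[OF len] by (auto simp: fun_eq_iff)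
    then have "q = 0" by (simp only: poly_eq_poly_eq_iff)
    then have "D (y # replicate m x @ ys) = 0"
      using q(2) Cons.IH[OF len] by simp
    moreover have "D (replicate m x @ y # ys) = D (y # replicate m x @ ys)"
      using len by (intro sym) auto
    ultimately show ?case by simp
  qed
  from this[of 0 xs] assms(4) show ?thesis by simp
qed

text \<open>The difference of two blossoms is symmetric, affine in each argument, and zero on the
  diagonal.\<close>

lemma is_blossom_unique:
  assumes B: "is_blossom d p B" and C: "is_blossom d p C" and "length xs = d"
  shows "B xs = C xs"
proof -
  have "B xs - C xs = 0"
  proof (rule symmetric_multiaffine_eq_0[where D = "\<lambda>xs. B xs - C xs" and d = d])
    fix xs ys :: "real list"
    assume "length xs = d" "mset xs = mset ys"
    then show "B xs - C xs = B ys - C ys"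
      using B C unfolding is_blossom_def by metis
  next
    fix xs :: "real list" and k
    assume k: "length xs = d" "k < d"
    obtain m c where "\<forall>x. B (xs[k := x]) = m * x + c"
      using B k unfolding is_blossom_def by blast
    moreover obtain m' c' where "\<forall>x. C (xs[k := x]) = m' * x + c'"
      using C k unfolding is_blossom_def by blast
    ultimately show "\<exists>m c. \<forall>x. B (xs[k := x]) - C (xs[k := x]) = m * x + c"
      by (intro exI[of _ "m - m'"] exI[of _ "c - c'"]) (simp add: algebra_simps)
  qed (use assms in \<open>auto simp: is_blossom_def\<close>)
  then show ?thesis by simp
qed

text \<open>Restricted to lists of length \<open>d\<close>, the polar form is extensional and hence
  the object picked by the definite description. All later work with blossoms uses this
  formula.\<close>

lemma blossom_eq_polar_form:
  assumes "degree p \<le> d" and "length xs = d"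
  shows "blossom d p xs = polar_form d p xs"
proof -
  let ?R = "restrict (polar_form d p) {xs. length xs = d}"
  have R: "?R xs = polar_form d p xs" if "length xs = d" for xs
    using that by simp
  have len: "length ys = d" if "length xs = d" "mset xs = mset ys" for xs ys :: "real list"
    using that by (metis size_mset)
  note P = is_blossom_polar_form[OF assms(1), unfolded is_blossom_def]
  have "is_blossom d p ?R"
    unfolding is_blossom_def
  proof (intro conjI allI impI)
    fix xs ys :: "real list"
    assume "length xs = d" "mset xs = mset ys"
    then show "?R xs = ?R ys"
      using P len[of xs ys] by (metis R)
  next
    fix xs :: "real list" and k
    assume "length xs = d" "k < d"
    then show "\<exists>m c. \<forall>x. ?R (xs[k := x]) = m * x + c"
      using conjunct1[OF conjunct2[OF P]] R by (metis length_list_update)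
  next
    fix x
    show "?R (replicate d x) = poly p x"
      using conjunct2[OF conjunct2[OF P]] R by (metis length_replicate)
  qed
  moreover from this have "B = ?R" if "B \<in> extensional {xs. length xs = d}" "is_blossom d p B" for B
    using that is_blossom_unique[of d p B ?R] by (intro extensionalityI[of B "{xs. length xs = d}"]) auto
  ultimately have "blossom d p = ?R"
    unfolding blossom_def by (intro the_equality) auto
  then show ?thesis using assms(2) by simp
qed

section \<open>Bernstein expansion and derivatives at a knot\<close>

lemma multi_indices_eq: "multi_indices d = (\<lambda>k. (k, d - k)) ` {..d}"
  by (force simp: multi_indices_def image_iff)

text \<open>The binomial theorem applies because \<open>[:1, x:]\<close> combines
  \<open>[:1, A:]\<close> and \<open>[:1, B:]\<close> with the barycentric coordinates of
  \<open>x\<close>. Under the pairing this expands diagonal arguments \<open>x\<close> into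
  arguments \<open>A\<close> and \<open>B\<close>.\<close>

lemma linear_power_bernstein:
  assumes "A \<noteq> B"
  shows "[:1, x:] ^ d =
    (\<Sum>\<alpha>\<in>multi_indices d. smult (bernstein d \<alpha> A B x) ([:1, A:] ^ fst \<alpha> * [:1, B:] ^ snd \<alpha>))"
proof -
  have lin: "[:1, x:] = smult ((B - x) / (B - A)) [:1, A:] + smult ((x - A) / (B - A)) [:1, B:]"
    using assms by (simp add: diff_divide_distrib[symmetric] add_divide_distrib[symmetric])
      (simp add: field_simps)
  have "[:1, x:] ^ d = (\<Sum>k\<le>d. smult (bernstein d (k, d - k) A B x) ([:1, A:] ^ k * [:1, B:] ^ (d - k)))"
    unfolding lin binomial_ring
  proof (intro sum.cong refl)
    fix k assume k: "k \<in> {..d}"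
    then have "bernstein d (k, d - k) A B x =
        real (d choose k) * (((B - x) / (B - A)) ^ k * ((x - A) / (B - A)) ^ (d - k))"
      by (simp add: bernstein_def binomial_fact power_divide flip: power_add)
    then show "of_nat (d choose k) * smult ((B - x) / (B - A)) [:1, A:] ^ k *
        smult ((x - A) / (B - A)) [:1, B:] ^ (d - k) =
        smult (bernstein d (k, d - k) A B x) ([:1, A:] ^ k * [:1, B:] ^ (d - k))"
      unfolding smult_power by (simp add: of_nat_poly mult_ac)
  qed
  then show ?thesis
    unfolding multi_indices_eq by (simp add: sum.reindex inj_on_def)
qed

text \<open>For each monomial, Pascal's rule splits the normalised coefficient in the proportions
  \<open>1 - k / d\<close> and \<open>k / d\<close>; the weight \<open>k\<close> produces the
  derivative. The left side is the polar form at one \<open>v\<close> and \<open>d - 1\<close>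
  copies of \<open>x\<close>.\<close>

lemma polar_pairing_linear_power:
  assumes "degree p \<le> d" "d > 0"
  shows "polar_pairing d p ([:1, v:] * [:1, x:] ^ (d - 1)) =
    poly (p + smult (1 / real d) ([:v, -1:] * pderiv p)) x"
proof -
  obtain e where d: "d = Suc e" using assms by (cases d) auto
  have c: "coeff p k * coeff ([:1, v:] * [:1, x:] ^ e) k / real (d choose k) =
      coeff p k * x ^ k + (v - x) / real d * (real k * coeff p k * x ^ (k - 1))" if "k \<le> d" for k
  proof (cases k)
    case 0
    then show ?thesis by (simp add: coeff_linear_poly_power)
  next
    case (Suc j)
    have co: "coeff ([:1, v:] * [:1, x:] ^ e) k = real (e choose k) * x ^ k + v * (real (e choose j) * x ^ j)"
    proof -
      have "coeff ([:1, x:] ^ e) i = real (e choose i) * x ^ i" for i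
      proof (cases "i \<le> e")
        case False
        have "degree ([:1, x:] ^ e) \<le> degree [:1, x:] * e" by (rule degree_power_le)
        also have "\<dots> \<le> e" by simp
        finally show ?thesis using False by (simp add: coeff_eq_0)
      qed (simp add: coeff_linear_poly_power)
      then show ?thesis unfolding Suc mult_pCons_left by simp
    qed
    have b1: "real (d choose k) * real k = real d * real (e choose j)"
      using arg_cong[OF Suc_times_binomial[of j e], of real] unfolding Suc d of_nat_mult
      by (simp only: mult.commute)
    have b2: "real (d choose k) = real (e choose k) + real (e choose j)"
      unfolding Suc d by simp
    have nz: "real (d choose k) \<noteq> 0" using that by simp
    have "real (e choose j) / real (d choose k) = real k / real d"
      using b1 nz d by (simp add: field_simps)
    moreover have "real (e choose k) / real (d choose k) = 1 - real (e choose j) / real (d choose k)"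
      using b2 nz by (simp add: field_simps)
    ultimately have r: "real (e choose j) / real (d choose k) = real k / real d"
      "real (e choose k) / real (d choose k) = 1 - real k / real d" by auto
    have "coeff p k * coeff ([:1, v:] * [:1, x:] ^ e) k / real (d choose k) =
      coeff p k * (real (e choose k) / real (d choose k) * x ^ k
         + v * (real (e choose j) / real (d choose k) * x ^ j))"
      unfolding co by (simp add: distrib_left add_divide_distrib)
    also have "\<dots> = coeff p k * x ^ k + (v - x) / real d * (real k * coeff p k * x ^ (k - 1))"
    proof -
      define w where "w = real k / real d"
      have "coeff p k * ((1 - w) * x ^ k + v * (w * x ^ j)) =
          coeff p k * x ^ k + (v - x) * (w * coeff p k * x ^ j)"
        by (simp add: Suc algebra_simps)
      then show ?thesis unfolding r w_def[symmetric] by (simp add: w_def Suc)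
    qed
    finally show ?thesis .
  qed
  have "poly (pderiv p) x = (\<Sum>k\<le>d. real k * coeff p k * x ^ (k - 1))"
  proof -
    have "poly (pderiv p) x = (\<Sum>k\<le>e. coeff (pderiv p) k * x ^ k)"
      using assms d by (intro poly_eq_sum_atMost) (simp add: degree_pderiv)
    also have "\<dots> = (\<Sum>k\<le>d. real k * coeff p k * x ^ (k - 1))"
      unfolding d by (subst sum.atMost_Suc_shift) (simp add: coeff_pderiv)
    finally show ?thesis .
  qed
  then have "(v - x) / real d * poly (pderiv p) x =
      (\<Sum>k\<le>d. (v - x) / real d * (real k * coeff p k * x ^ (k - 1)))"
    by (simp only: sum_distrib_left)
  moreover have "polar_pairing d p ([:1, v:] * [:1, x:] ^ e) =
      (\<Sum>k\<le>d. coeff p k * x ^ k + (v - x) / real d * (real k * coeff p k * x ^ (k - 1)))"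
    unfolding polar_pairing_def using c by (intro sum.cong refl) auto
  ultimately have "polar_pairing d p ([:1, v:] * [:1, x:] ^ e) =
      poly p x + (v - x) / real d * poly (pderiv p) x"
    by (simp only: sum.distrib poly_eq_sum_atMost[OF assms(1), symmetric])
  moreover have "e = d - 1" using d by simp
  ultimately show ?thesis by (simp only: poly_add poly_smult poly_mult) simp
qed

lemma higher_pderiv_pcompose_linear:
  "(pderiv ^^ j) (pcompose q [:c, h:]) = smult (h ^ j) (pcompose ((pderiv ^^ j) q) [:c, h:])"
  for q :: "real poly"
  by (induction j)
    (simp_all add: pderiv_smult pderiv_pcompose pderiv_pCons algebra_simps)

text \<open>The Leibniz rule for a linear factor has only two terms, and at \<open>v\<close> the
  first of them vanishes.\<close>

lemma higher_pderiv_linear_mult_pderiv: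
  "(pderiv ^^ j) ([:v, -1:] * pderiv p) =
    [:v, -1:] * (pderiv ^^ Suc j) p - smult (real j) ((pderiv ^^ j) p)"
proof (induction j)
  case (Suc j)
  have "pderiv [:v, -1:] = [:-1:]" by (simp add: pderiv_pCons)
  then show ?case
    unfolding funpow.simps comp_apply Suc
    by (simp only: pderiv_diff pderiv_mult pderiv_smult) (simp add: algebra_simps smult_add_left)
qed simp

lemma higher_deriv_poly: "(deriv ^^ j) (poly q) = poly ((pderiv ^^ j) q)" for q :: "real poly"
  by (induction j) (auto intro!: DERIV_imp_deriv poly_DERIV)

definition bernstein_poly :: "nat \<Rightarrow> nat \<times> nat \<Rightarrow> real \<Rightarrow> real \<Rightarrow> real poly" where
  "bernstein_poly d \<alpha> A B =
    smult (fact d / (fact (fst \<alpha>) * fact (snd \<alpha>)) / (B - A) ^ d)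
      ([:B, -1:] ^ fst \<alpha> * [:-A, 1:] ^ snd \<alpha>)"

lemma poly_bernstein_poly: "poly (bernstein_poly d \<alpha> A B) = bernstein d \<alpha> A B"
  by (auto simp: bernstein_poly_def bernstein_def)

text \<open>Numerator and denominator both scale by \<open>h ^ d\<close>, because the entries of
  \<alpha> sum to \<open>d\<close>. This transports the Bernstein basis to the contracted
  interval.\<close>

lemma bernstein_affine:
  assumes "h \<noteq> 0" "\<alpha> \<in> multi_indices d"
  shows "bernstein d \<alpha> (h * A + c) (h * B + c) (h * x + c) = bernstein d \<alpha> A B x"
proof -
  have "h * B + c - (h * x + c) = h * (B - x)" "h * x + c - (h * A + c) = h * (x - A)"
    "h * B + c - (h * A + c) = h * (B - A)"
    by (simp_all add: algebra_simps)
  moreover have "d = fst \<alpha> + snd \<alpha>" using assms(2) by (simp add: multi_indices_def)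
  ultimately show ?thesis
    using assms(1) by (simp add: bernstein_def power_mult_distrib power_add)
qed

text \<open>By the Bernstein expansion, \<open>\<Sum>\<^sub>\<alpha> B[p](v, A[\<alpha>\<^sub>1], B[\<alpha>\<^sub>2]) \<BB>\<^sub>\<alpha>\<close> over the contracted
  interval is \<open>B[p](v, x[d-1])\<close> up to the contraction, and the latter equals
  \<open>p x + (v - x) p' x / d\<close>; at \<open>v\<close> its \<open>j\<close>-th derivative is \<open>(1 - j / d)\<close> times that of \<open>p\<close>.\<close>

lemma sum_blossom_bernstein_deriv:
  fixes p :: "real poly"
  assumes deg: "degree p \<le> d" and d: "d > 0" and j: "j < d" and "A \<noteq> B" and h: "h \<noteq> 0"
  shows "(\<Sum>\<alpha>\<in>multi_indices (d - 1).
      blossom d p (v # replicate (fst \<alpha>) A @ replicate (snd \<alpha>) B) *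
      (real (d choose j) / real ((d - 1) choose j) * h ^ j *
       (deriv ^^ j) (bernstein (d - 1) \<alpha> (h * A + (1 - h) * v) (h * B + (1 - h) * v)) v)) =
    poly ((pderiv ^^ j) p) v" (is "(\<Sum>\<alpha>\<in>?I. ?b \<alpha> * (?c * ?f \<alpha>)) = _")
proof -
  define g where "g = p + smult (1 / real d) ([:v, -1:] * pderiv p)"
  define bp where "bp \<alpha> = bernstein_poly (d - 1) \<alpha> (h * A + (1 - h) * v) (h * B + (1 - h) * v)" for \<alpha>
  define q where "q = (\<Sum>\<alpha>\<in>?I. smult (?b \<alpha>) (bp \<alpha>))"
  have b: "?b \<alpha> = polar_pairing d p ([:1, v:] * ([:1, A:] ^ fst \<alpha> * [:1, B:] ^ snd \<alpha>))"
    if "\<alpha> \<in> ?I" for \<alpha>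
  proof -
    have "length (v # replicate (fst \<alpha>) A @ replicate (snd \<alpha>) B) = d"
      using that d by (simp add: multi_indices_def)
    then show ?thesis
      by (simp only: blossom_eq_polar_form[OF deg])
        (simp only: polar_form_def list.map prod_list.Cons map_append prod_list.append
          map_replicate prod_list_replicate)
  qed
  \<comment> \<open>Composition with the contraction pulls the Bernstein polynomials back to those
    for \<open>A\<close> and \<open>B\<close>, where the expansion of the linear power sums
    them.\<close>
  have "pcompose q [:(1 - h) * v, h:] = g"
  proof (rule poly_ext)
    fix x
    have "poly (pcompose q [:(1 - h) * v, h:]) x =
        (\<Sum>\<alpha>\<in>?I. ?b \<alpha> * bernstein (d - 1) \<alpha> (h * A + (1 - h) * v) (h * B + (1 - h) * v) (h * x + (1 - h) * v))"
      by (simp add: poly_pcompose q_def poly_sum bp_def poly_bernstein_poly add_ac mult_ac)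
    also have "\<dots> = (\<Sum>\<alpha>\<in>?I. ?b \<alpha> * bernstein (d - 1) \<alpha> A B x)"
      using h by (intro sum.cong refl) (simp add: bernstein_affine)
    also have "\<dots> = polar_pairing d p ([:1, v:] * [:1, x:] ^ (d - 1))"
      by (subst linear_power_bernstein[OF \<open>A \<noteq> B\<close>])
        (simp only: sum_distrib_left polar_pairing_sum_right mult_smult_right
          polar_pairing_smult_right b mult.commute cong: sum.cong)
    also have "\<dots> = poly g x"
      unfolding g_def by (rule polar_pairing_linear_power[OF deg d])
    finally show "poly (pcompose q [:(1 - h) * v, h:]) x = poly g x" .
  qed
  \<comment> \<open>The contraction fixes \<open>v\<close>, so the chain rule contributes exactly
    \<open>h ^ j\<close>.\<close>
  then have "poly ((pderiv ^^ j) g) v = h ^ j * poly ((pderiv ^^ j) q) v"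
    by (simp add: higher_pderiv_pcompose_linear poly_pcompose algebra_simps flip: \<open>_ = g\<close>)
  also have "poly ((pderiv ^^ j) q) v = (\<Sum>\<alpha>\<in>?I. ?b \<alpha> * poly ((pderiv ^^ j) (bp \<alpha>)) v)"
    by (simp add: q_def higher_pderiv_sum higher_pderiv_smult poly_sum)
  finally have 1: "h ^ j * (\<Sum>\<alpha>\<in>?I. ?b \<alpha> * poly ((pderiv ^^ j) (bp \<alpha>)) v) = poly ((pderiv ^^ j) g) v"
    by simp
  have 2: "poly ((pderiv ^^ j) g) v = (1 - real j / real d) * poly ((pderiv ^^ j) p) v"
    unfolding g_def higher_pderiv_add higher_pderiv_smult higher_pderiv_linear_mult_pderiv
    by (simp add: algebra_simps)
  \<comment> \<open>The binomial quotient in the weights is the reciprocal of the factor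
    \<open>1 - j / d\<close> just found.\<close>
  have 3: "real (d choose j) / real ((d - 1) choose j) * (1 - real j / real d) = 1"
  proof -
    have "real (d - j) * real (d choose j) = real d * real ((d - 1) choose j)"
      using binomial_absorb_comp[of d j] by (metis of_nat_mult)
    moreover have "real ((d - 1) choose j) \<noteq> 0" using j by simp
    ultimately show ?thesis using d j by (simp add: of_nat_diff field_simps)
  qed
  have "(\<Sum>\<alpha>\<in>?I. ?b \<alpha> * (real (d choose j) / real ((d - 1) choose j) * h ^ j *
       (deriv ^^ j) (bernstein (d - 1) \<alpha> (h * A + (1 - h) * v) (h * B + (1 - h) * v)) v)) =
      real (d choose j) / real ((d - 1) choose j) *
        (h ^ j * (\<Sum>\<alpha>\<in>?I. ?b \<alpha> * poly ((pderiv ^^ j) (bp \<alpha>)) v))"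
    unfolding sum_distrib_left bp_def higher_deriv_poly[symmetric] poly_bernstein_poly
    by (intro sum.cong refl) (simp only: mult_ac)
  also have "\<dots> = poly ((pderiv ^^ j) p) v"
    unfolding 1 2 using 3 by (metis mult.assoc mult_1)
  finally show ?thesis .
qed

section \<open>Lagrange interpolation under the blossom\<close>

lemma lagrange_interpolation:
  fixes p :: "real poly"
  assumes deg: "degree p \<le> d" and inj: "inj_on t {0..d}"
    and L: "\<And>j. j \<le> d \<Longrightarrow> degree (L j) \<le> d"
    and Lt: "\<And>j k. j \<le> d \<Longrightarrow> k \<le> d \<Longrightarrow> poly (L j) (t k) = (if j = k then 1 else 0)"
  shows "p = (\<Sum>k=0..d. smult (poly p (t k)) (L k))"
proof (rule poly_eqI_degree[where A = "t ` {0..d}"])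
  fix x assume "x \<in> t ` {0..d}"
  then obtain k where k: "k \<le> d" "x = t k" by auto
  have "(\<Sum>i=0..d. poly p (t i) * poly (L i) (t k)) = (\<Sum>i=0..d. if i = k then poly p (t i) else 0)"
    using k by (intro sum.cong) (auto simp: Lt)
  then show "poly p x = poly (\<Sum>k=0..d. smult (poly p (t k)) (L k)) x"
    using k by (simp add: poly_sum)
next
  have c: "card (t ` {0..d}) = Suc d" using inj by (simp add: card_image)
  then show "degree p < card (t ` {0..d})" using deg by simp
  have "degree (\<Sum>k=0..d. smult (poly p (t k)) (L k)) \<le> d"
    using L by (intro degree_sum_le) (auto intro: order.trans[OF degree_smult_le])
  then show "degree (\<Sum>k=0..d. smult (poly p (t k)) (L k)) < card (t ` {0..d})"
    using c by simp
qed

text \<open>The pairing is linear in the polynomial, so the blossom passes through the Lagrange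
  expansion of \<open>p\<close>.\<close>

lemma sum_blossom_lagrange:
  fixes p :: "real poly"
  assumes deg: "degree p \<le> d" and inj: "inj_on t {0..d}"
    and L: "\<And>j. j \<le> d \<Longrightarrow> degree (L j) \<le> d"
    and Lt: "\<And>j k. j \<le> d \<Longrightarrow> k \<le> d \<Longrightarrow> poly (L j) (t k) = (if j = k then 1 else 0)"
    and xs: "length xs = d"
  shows "(\<Sum>k=0..d. poly p (t k) * blossom d (L k) xs) = blossom d p xs"
proof -
  have "blossom d p xs = polar_form d (\<Sum>k=0..d. smult (poly p (t k)) (L k)) xs"
    using blossom_eq_polar_form[OF deg xs] lagrange_interpolation[OF deg inj L Lt] by simp
  also have "\<dots> = (\<Sum>k=0..d. poly p (t k) * blossom d (L k) xs)"
    unfolding polar_form_def polar_pairing_sum_smult_left using L xs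
    by (intro sum.cong refl) (simp add: blossom_eq_polar_form polar_form_def)
  finally show ?thesis by simp
qed

section \<open>Hermite interpolation by splines\<close>

lemma higher_pderiv_translate:
  "(pderiv ^^ j) (pcompose p [:c, 1:]) = pcompose ((pderiv ^^ j) p) [:c, 1:]" for p :: "real poly"
  by (induction j) (simp_all add: pderiv_pcompose pderiv_pCons)

text \<open>Translating \<open>v\<close> to the origin turns each Hermite condition into a condition
  on a single coefficient.\<close>

lemma poly_higher_pderiv_eq_coeff:
  "poly ((pderiv ^^ j) p) v = fact j * coeff (pcompose p [:v, 1:]) j" for p :: "real poly"
proof -
  have "poly ((pderiv ^^ j) p) v = coeff ((pderiv ^^ j) (pcompose p [:v, 1:])) 0"
    by (simp add: higher_pderiv_translate poly_pcompose flip: poly_0_coeff_0)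
  also have "\<dots> = fact j * coeff (pcompose p [:v, 1:]) j"
    by (simp add: coeff_higher_pderiv pochhammer_fact)
  finally show ?thesis .
qed

text \<open>In the Taylor expansion at \<open>v\<close>, the data kill the coefficients below
  \<open>m\<close> and the degree bound kills those above.\<close>

lemma poly_eq_monom_of_higher_pderiv_eq_0:
  fixes p :: "real poly"
  assumes "degree p \<le> m" and "\<And>j. j < m \<Longrightarrow> poly ((pderiv ^^ j) p) v = 0"
  obtains c where "p = smult c ([:-v, 1:] ^ m)"
proof
  let ?P = "pcompose p [:v, 1:]"
  have "?P = monom (coeff ?P m) m"
  proof (rule poly_eqI)
    fix j
    have "coeff ?P j = 0" if "j < m"
      using assms(2)[OF that] by (simp add: poly_higher_pderiv_eq_coeff)
    moreover have "coeff ?P j = 0" if "m < j"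
      using assms(1) that by (intro coeff_eq_0) (simp add: degree_pcompose)
    ultimately show "coeff ?P j = coeff (monom (coeff ?P m) m) j"
      by (cases j m rule: linorder_cases) auto
  qed
  then have P: "poly ?P y = coeff ?P m * y ^ m" for y
    by (metis poly_monom)
  show "p = smult (coeff ?P m) ([:-v, 1:] ^ m)"
    by (rule poly_ext) (use P[of "_ - v"] in \<open>simp add: poly_pcompose\<close>)
qed

lemma poly_higher_pderiv_linear_power_eq_0:
  fixes v :: real
  assumes "j < m"
  shows "poly ((pderiv ^^ j) ([:-v, 1:] ^ m)) v = 0"
proof -
  have "pcompose ([:-v, 1:] ^ m) [:v, 1:] = monom 1 m"
    by (rule poly_ext) (simp add: poly_pcompose poly_monom)
  then show ?thesis using assms by (simp add: poly_higher_pderiv_eq_coeff)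
qed

lemma ex_poly_higher_pderiv:
  fixes c :: "nat \<Rightarrow> real"
  shows "\<exists>p. degree p \<le> m \<and> (\<forall>j\<le>m. poly ((pderiv ^^ j) p) v = c j)"
proof -
  define P where "P = (\<Sum>j\<le>m. monom (c j / fact j) j)"
  have "degree P \<le> m"
    unfolding P_def by (intro degree_sum_le) (auto intro: order.trans[OF degree_monom_le])
  moreover have "coeff P j = c j / fact j" if "j \<le> m" for j
    using that by (simp add: P_def coeff_sum)
  moreover have "pcompose (pcompose P [:-v, 1:]) [:v, 1:] = P"
    by (simp add: pcompose_pCons flip: pcompose_assoc)
  ultimately show ?thesis
    by (intro exI[of _ "pcompose P [:-v, 1:]"])
      (simp add: poly_higher_pderiv_eq_coeff degree_pcompose)
qed

text \<open>The determinant of the \<open>C\<^sup>1\<close> conditions at \<open>z\<close> is, up to sign and powers of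
  \<open>z - v\<close> and \<open>z - w\<close>, equal to \<open>m' (z - v) + m (w - z)\<close>, which is positive.\<close>

lemma ex_joins_1:
  fixes p q :: "real poly"
  assumes "v < z" "z < w" "m > 0" "m' > 0"
  shows "\<exists>c d. joins 1 (p + smult c ([:-v, 1:] ^ m)) (q + smult d ([:-w, 1:] ^ m')) z"
proof -
  obtain k k' where k: "m = Suc k" "m' = Suc k'" using assms by (cases m; cases m') auto
  define h l where "h = z - v" "l = w - z"
  define A B where "A = poly q z - poly p z" "B = poly (pderiv q) z - poly (pderiv p) z"
  have pos: "h > 0" "l > 0" using assms by (auto simp: h_l_def)
  define D where "D = h * m' + l * m"
  have "D > 0" using pos assms unfolding D_def by (simp add: add_pos_pos)
  \<comment> \<open>Cramer's rule for the unknowns \<open>c * h ^ k\<close> and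
    \<open>d * (- l) ^ k'\<close>; the equations for value and slope have determinant
    \<open>D\<close> up to sign.\<close>
  define c d where "c = (A * m' + B * l) / D / h ^ k" "d = (A * m - B * h) / D / (- l) ^ k'"
  have c: "c * h ^ k = (A * m' + B * l) / D" and d: "d * (- l) ^ k' = (A * m - B * h) / D"
    using pos by (auto simp: c_d_def)
  have "c * h ^ m - d * (- l) ^ m' = (c * h ^ k) * h + (d * (- l) ^ k') * l"
    by (simp add: k)
  also have "\<dots> = A"
    using \<open>D > 0\<close> unfolding c d by (simp add: field_simps) (simp add: D_def algebra_simps)
  finally have 1: "c * h ^ m - d * (- l) ^ m' = A" .
  have "m * (c * h ^ k) - m' * (d * (- l) ^ k') = B"
    using \<open>D > 0\<close> unfolding c d by (simp add: field_simps) (simp add: D_def algebra_simps)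
  then have 2: "c * (m * h ^ k) - d * (m' * (- l) ^ k') = B" by (simp add: mult_ac)
  have pd: "pderiv ([:-x, 1:] ^ Suc i) = smult (real (Suc i)) ([:-x, 1:] ^ i)" for x :: real and i
    by (simp add: pderiv_power_Suc pderiv_pCons del: power_Suc)
  have zz: "poly [:-v, 1:] z = h" "poly [:-w, 1:] z = - l" by (auto simp: h_l_def)
  have "poly (p + smult c ([:-v, 1:] ^ m)) z = poly (q + smult d ([:-w, 1:] ^ m')) z"
    using 1 zz by (simp add: A_B_def)
  moreover have "poly (pderiv (p + smult c ([:-v, 1:] ^ m))) z =
      poly (pderiv (q + smult d ([:-w, 1:] ^ m'))) z"
    using 2 zz unfolding k pderiv_add pderiv_smult pd by (simp add: A_B_def)
  ultimately show ?thesis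
    unfolding joins_def by (intro exI[of _ c] exI[of _ d]) (auto simp: le_Suc_eq)
qed

text \<open>The value condition \<open>C * h = - (E * l)\<close> rules out equal signs of
  \<open>C\<close> and \<open>E\<close>, the slope condition \<open>m * C = m' * E\<close> rules out
  opposite ones, so both vanish.\<close>

lemma joins_1_unique:
  fixes c d :: real
  assumes "v < z" "z < w" "m > 0" "m' > 0"
    and "joins 1 (smult c ([:-v, 1:] ^ m)) (smult d ([:-w, 1:] ^ m')) z"
  shows "c = 0 \<and> d = 0"
proof -
  obtain k k' where k: "m = Suc k" "m' = Suc k'" using assms by (cases m; cases m') auto
  define h l where "h = z - v" "l = w - z"
  have pos: "h > 0" "l > 0" using assms by (auto simp: h_l_def)
  have pd: "pderiv ([:-x, 1:] ^ Suc i) = smult (real (Suc i)) ([:-x, 1:] ^ i)" for x :: real and i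
    by (simp add: pderiv_power_Suc pderiv_pCons del: power_Suc)
  have zz: "poly [:-v, 1:] z = h" "poly [:-w, 1:] z = - l" by (auto simp: h_l_def)
  define C E where "C = c * h ^ k" "E = d * (- l) ^ k'"
  have "c * h ^ m = d * (- l) ^ m'"
    using assms(5) zz unfolding joins_def by (auto dest!: spec[of _ 0])
  then have 1: "C * h = - (E * l)" by (simp add: k C_E_def mult_ac)
  have "c * (m * h ^ k) = d * (m' * (- l) ^ k')"
    using assms(5)[unfolded joins_def, rule_format, of 1] zz unfolding k by (simp add: pderiv_smult pd del: power_Suc)
  then have 2: "m * C = m' * E" by (simp add: C_E_def mult_ac)
  have "E * (m' * h + m * l) = (m' * E) * h + m * (E * l)" by (simp add: algebra_simps)
  also have "\<dots> = m * (C * h) + m * (E * l)" unfolding 2[symmetric] by (simp add: algebra_simps)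
  also have "\<dots> = 0" unfolding 1 by simp
  finally have "E * (m' * h + m * l) = 0" .
  moreover have "m' * h + m * l > 0" using pos assms by (simp add: add_pos_pos)
  ultimately have "E = 0" by simp
  with 1 pos have "C = 0" by simp
  with \<open>E = 0\<close> pos show ?thesis by (simp add: C_E_def)
qed

text \<open>Induction on the order: below order \<open>m\<close> the glued derivatives are
  differentiable at \<open>v\<close>, since values and slopes of both pieces agree. The claim covers
  all \<open>x\<close> in \<open>U\<close> because the next derivative needs neighbouring
  values.\<close>

lemma nth_deriv_on_piecewise_poly:
  assumes "a < b" "v \<in> {a..b}" "open U" "v \<in> U" and J: "joins m l r v"
    and l: "\<And>x. x \<in> {a..b} \<inter> U \<Longrightarrow> x \<le> v \<Longrightarrow> s x = poly l x"
    and r: "\<And>x. x \<in> {a..b} \<inter> U \<Longrightarrow> v \<le> x \<Longrightarrow> s x = poly r x"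
    and "j \<le> m" and "x \<in> {a..b} \<inter> U"
  shows "nth_deriv_on a b j s x =
    (if x \<le> v then poly ((pderiv ^^ j) l) x else poly ((pderiv ^^ j) r) x)"
  using assms(8,9)
proof (induction j arbitrary: x)
  case 0
  then show ?case using l r by (auto simp: nth_deriv_on_def)
next
  case (Suc j)
  let ?F = "\<lambda>j x. if x \<in> {..v} then poly ((pderiv ^^ j) l) x else poly ((pderiv ^^ j) r) x"
  have pd: "(poly q has_vector_derivative poly (pderiv q) y) (at y within S)" for q :: "real poly" and y S
    using poly_DERIV has_field_derivative_at_within has_real_derivative_iff_has_vector_derivative
    by blast
  have "(?F j has_vector_derivative ?F (Suc j) x) (at x within UNIV)"
  proof (rule has_vector_derivative_If_within_closures[where T = "{v..}"])
    show "x \<in> {..v} \<union> {v..}" "UNIV = {..v} \<union> {v..}" by auto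
    show "poly ((pderiv ^^ j) l) x = poly ((pderiv ^^ j) r) x"
      "poly ((pderiv ^^ Suc j) l) x = poly ((pderiv ^^ Suc j) r) x"
      if "x \<in> closure {..v}" "x \<in> closure {v..}"
      using that J Suc.prems unfolding joins_def by auto
  qed (simp_all add: pd)
  then have F: "(?F j has_vector_derivative ?F (Suc j) x) (at x within {a..b})"
    by (rule has_vector_derivative_at_within)
  obtain e where e: "e > 0" "ball x e \<subseteq> U"
    using Suc.prems \<open>open U\<close> by (meson IntD2 openE)
  from F e(1) have "(nth_deriv_on a b j s has_vector_derivative ?F (Suc j) x) (at x within {a..b})"
  proof (rule has_vector_derivative_transform_within)
    show "x \<in> {a..b}" using Suc.prems by simp
    fix y assume "y \<in> {a..b}" "dist y x < e"
    then have "y \<in> {a..b} \<inter> U" using e by (auto simp: dist_commute)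
    then show "?F j y = nth_deriv_on a b j s y"
      using Suc.IH[of y] Suc.prems by simp
  qed
  then have "vector_derivative (nth_deriv_on a b j s) (at x within {a..b}) = ?F (Suc j) x"
    using \<open>a < b\<close> Suc.prems by (intro vector_derivative_within_closed_interval) auto
  then show ?case by (simp add: nth_deriv_on_def)
qed

section \<open>Knots, splines and their Hermite data\<close>

locale spline_knots =
  fixes n :: nat and v :: "nat \<Rightarrow> real" and \<zeta> :: "int \<Rightarrow> real" and \<phi> :: "nat \<Rightarrow> nat"
  assumes n_pos: "n \<ge> 1"
    and v_less: "\<And>i. i < n \<Longrightarrow> v i < v (i + 1)"
    and zeta_mem: "\<And>i. i < n \<Longrightarrow> \<zeta> (int i) \<in> {v i<..<v (i + 1)}"
    and zeta_first: "\<zeta> (- 1) = v 0" and zeta_last: "\<zeta> (int n) = v n"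
    and phi_ge: "\<And>i. i \<le> n \<Longrightarrow> \<phi> i \<ge> 2"
begin

lemma zeta_pred_less: "0 < i \<Longrightarrow> i \<le> n \<Longrightarrow> \<zeta> (int i - 1) < v i"
  using zeta_mem[of "i - 1"] by (auto simp: of_nat_diff)

lemma less_zeta: "i < n \<Longrightarrow> v i < \<zeta> (int i)"
  using zeta_mem by auto

lemma zeta_pred_le: "i \<le> n \<Longrightarrow> \<zeta> (int i - 1) \<le> v i"
  using zeta_pred_less[of i] zeta_first by (cases "i = 0") auto

lemma le_zeta: "i \<le> n \<Longrightarrow> v i \<le> \<zeta> (int i)"
  using less_zeta[of i] zeta_last by (cases "i = n") auto

lemma zeta_pred_less_zeta: "i \<le> n \<Longrightarrow> \<zeta> (int i - 1) < \<zeta> (int i)"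
  using zeta_pred_less[of i] zeta_pred_le[of i] less_zeta[of i] le_zeta[of i] n_pos
  by (cases "i = 0") auto

lemma v_mono: "i \<le> j \<Longrightarrow> j \<le> n \<Longrightarrow> v i \<le> v j"
proof (induction rule: dec_induct)
  case (step j)
  then show ?case using v_less[of j] by simp
qed simp

lemma zeta_mono: "i \<le> j \<Longrightarrow> j \<le> n \<Longrightarrow> \<zeta> (int i) \<le> \<zeta> (int j)"
proof (induction rule: dec_induct)
  case (step j)
  then show ?case using zeta_pred_less_zeta[of "Suc j"] by auto
qed simp

lemma v_first_less_last: "v 0 < v n"
  using v_less[of 0] v_mono[of 1 n] n_pos by auto

lemma v_bounds: "i \<le> n \<Longrightarrow> v i \<in> {v 0..v n}"
  using v_mono by auto

text \<open>The half-open cells between consecutive \<zeta> are disjoint by monotonicity, so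
  \<open>LEAST\<close> can select the cell when a spline is assembled from pieces.\<close>

lemma Least_zeta_eq:
  assumes "i \<le> n" "\<zeta> (int i - 1) < x" "x \<le> \<zeta> (int i)"
  shows "(LEAST i. x \<le> \<zeta> (int i)) = i"
proof (rule Least_equality)
  fix j assume "x \<le> \<zeta> (int j)"
  show "i \<le> j"
  proof (rule ccontr)
    assume "\<not> i \<le> j"
    then have "\<zeta> (int j) \<le> \<zeta> (int (i - 1))" using assms(1) by (intro zeta_mono) auto
    also have "int (i - 1) = int i - 1" using \<open>\<not> i \<le> j\<close> by auto
    finally show False using assms \<open>x \<le> \<zeta> (int j)\<close> by simp
  qed
qed (use assms in auto)

lemma ex_zeta_interval:
  assumes "x \<in> {v 0..v n}"
  obtains i where "i \<le> n" "x \<in> {\<zeta> (int i - 1)..\<zeta> (int i)}"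
proof -
  define i where "i = (LEAST i. x \<le> \<zeta> (int i))"
  have ex: "x \<le> \<zeta> (int n)" using assms zeta_last by simp
  have "x \<le> \<zeta> (int i)" unfolding i_def by (rule LeastI[of "\<lambda>i. x \<le> \<zeta> (int i)", OF ex])
  moreover have "i \<le> n" unfolding i_def by (rule Least_le[of "\<lambda>i. x \<le> \<zeta> (int i)", OF ex])
  moreover have "\<zeta> (int i - 1) \<le> x"
  proof (cases i)
    case 0
    then show ?thesis using assms zeta_first by simp
  next
    case (Suc k)
    then have "\<not> x \<le> \<zeta> (int k)" unfolding i_def by (intro not_less_Least) simp
    with Suc show ?thesis by simp
  qed
  ultimately show thesis using that by auto
qed

text \<open>In contrast to \<open>spline_space\<close>, the degenerate pieces \<open>l 0\<close> and \<open>r n\<close> are constrained as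
  well; replacing them by \<open>r 0\<close> and \<open>l n\<close> makes all knots \<open>v i\<close> alike.\<close>

definition spline_pieces :: "(nat \<Rightarrow> real poly) \<Rightarrow> (nat \<Rightarrow> real poly) \<Rightarrow> (real \<Rightarrow> real) \<Rightarrow> bool" where
  "spline_pieces l r s \<longleftrightarrow>
     (\<forall>i\<le>n. degree (l i) \<le> \<phi> i \<and> degree (r i) \<le> \<phi> i \<and> joins (\<phi> i - 1) (l i) (r i) (v i) \<and>
        (\<forall>x\<in>{\<zeta> (int i - 1)..v i}. s x = poly (l i) x) \<and>
        (\<forall>x\<in>{v i..\<zeta> (int i)}. s x = poly (r i) x)) \<and>
     (\<forall>i<n. joins 1 (r i) (l (i + 1)) (\<zeta> (int i)))"

definition is_spline :: "(real \<Rightarrow> real) \<Rightarrow> bool" where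
  "is_spline s \<longleftrightarrow> (\<exists>l r. spline_pieces l r s)"

abbreviation D :: "nat \<Rightarrow> (real \<Rightarrow> real) \<Rightarrow> real \<Rightarrow> real" where
  "D \<equiv> nth_deriv_on (v 0) (v n)"

text \<open>A degenerate interval is a single point, where the piece on the other side already has
  the value of \<open>s\<close>; copying that piece meets the extra requirements.\<close>

lemma spline_space_iff:
  "s \<in> spline_space n v \<zeta> \<phi> \<longleftrightarrow> s \<in> extensional {v 0..v n} \<and> is_spline s"
proof (intro iffI conjI)
  assume "s \<in> spline_space n v \<zeta> \<phi>"
  then obtain l r where s: "s \<in> extensional {v 0..v n}"
    and l: "\<forall>i. 0 < i \<and> i \<le> n \<longrightarrow> degree (l i) \<le> \<phi> i \<and> (\<forall>x\<in>{\<zeta> (int i - 1)..v i}. s x = poly (l i) x)"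
    and r: "\<forall>i<n. degree (r i) \<le> \<phi> i \<and> (\<forall>x\<in>{v i..\<zeta> (int i)}. s x = poly (r i) x)"
    and j: "\<forall>i. 0 < i \<and> i < n \<longrightarrow> joins (\<phi> i - 1) (l i) (r i) (v i)"
    and j1: "\<forall>i<n. joins 1 (r i) (l (i + 1)) (\<zeta> (int i))"
    unfolding spline_space_def mem_Collect_eq by (elim conjE exE)
  show "s \<in> extensional {v 0..v n}" by fact
  have "spline_pieces (l(0 := r 0)) (r(n := l n)) s"
    unfolding spline_pieces_def
  proof (intro conjI allI impI)
    fix i assume i: "i \<le> n"
    consider "i = 0" | "0 < i" "i < n" | "i = n" "i \<noteq> 0" using i n_pos by linarith
    note cs = this
    show "degree ((l(0 := r 0)) i) \<le> \<phi> i"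
      using cs by cases (use l r n_pos in auto)
    show "degree ((r(n := l n)) i) \<le> \<phi> i"
      using cs by cases (use l r n_pos in auto)
    show "joins (\<phi> i - 1) ((l(0 := r 0)) i) ((r(n := l n)) i) (v i)"
      using cs
    proof cases
      case 2
      then show ?thesis using j by simp
    qed (use n_pos in \<open>auto simp: joins_def\<close>)
    show "\<forall>x\<in>{\<zeta> (int i - 1)..v i}. s x = poly ((l(0 := r 0)) i) x"
      using cs
    proof cases
      case 1
      then show ?thesis using r n_pos zeta_first less_zeta[of 0] by auto
    qed (use l in auto)
    show "\<forall>x\<in>{v i..\<zeta> (int i)}. s x = poly ((r(n := l n)) i) x"
      using cs
    proof cases
      case 3
      then show ?thesis using l zeta_last zeta_pred_less[of n] by auto
    qed (use r n_pos in auto)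
  qed (use j1 in auto)
  then show "is_spline s" unfolding is_spline_def by blast
next
  assume s: "s \<in> extensional {v 0..v n} \<and> is_spline s"
  then obtain l r where "spline_pieces l r s" unfolding is_spline_def by blast
  then have P: "(\<forall>i. 0 < i \<and> i \<le> n \<longrightarrow> degree (l i) \<le> \<phi> i \<and> (\<forall>x\<in>{\<zeta> (int i - 1)..v i}. s x = poly (l i) x)) \<and>
      (\<forall>i<n. degree (r i) \<le> \<phi> i \<and> (\<forall>x\<in>{v i..\<zeta> (int i)}. s x = poly (r i) x)) \<and>
      (\<forall>i. 0 < i \<and> i < n \<longrightarrow> joins (\<phi> i - 1) (l i) (r i) (v i)) \<and>
      (\<forall>i<n. joins 1 (r i) (l (i + 1)) (\<zeta> (int i)))"
    unfolding spline_pieces_def by (intro conjI; simp)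
  show "s \<in> spline_space n v \<zeta> \<phi>"
    unfolding spline_space_def
    by (rule CollectI, rule conjI[OF conjunct1[OF s]], rule exI[of _ l], rule exI[of _ r], rule P)
qed

lemma spline_pieces_cong:
  assumes lr: "spline_pieces l r s" and "\<And>x. x \<in> {v 0..v n} \<Longrightarrow> s x = s' x"
  shows "spline_pieces l r s'"
proof -
  have "x \<in> {v 0..v n}" if "i \<le> n" "x \<in> {\<zeta> (int i - 1)..\<zeta> (int i)}" for i x
  proof -
    have "\<zeta> (int i) \<le> v n" using zeta_mono[of i n] that zeta_last by simp
    moreover have "v 0 \<le> \<zeta> (int i - 1)"
      using zeta_mono[of 0 "i - 1"] le_zeta[of 0] that zeta_first by (cases i) auto
    ultimately show ?thesis using that by auto
  qed
  then have "s' x = s x" if "i \<le> n" "x \<in> {\<zeta> (int i - 1)..v i} \<union> {v i..\<zeta> (int i)}" for i x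
    using that assms(2)[of x] zeta_pred_le[of i] le_zeta[of i] by force
  then show ?thesis using lr unfolding spline_pieces_def by auto
qed

lemma spline_pieces_deriv:
  assumes lr: "spline_pieces l r s" and i: "i \<le> n" and j: "j \<le> \<phi> i - 1"
  shows "D j s (v i) = poly ((pderiv ^^ j) (l i)) (v i)"
    and "poly ((pderiv ^^ j) (r i)) (v i) = poly ((pderiv ^^ j) (l i)) (v i)"
proof -
  \<comment> \<open>Within the spline interval, \<open>U\<close> meets only the two pieces at
    \<open>v i\<close>. At an end knot the outer side is left unbounded, which keeps
    \<open>v i\<close> inside the open set.\<close>
  define U where "U = (if i = 0 then UNIV else {\<zeta> (int i - 1)<..}) \<inter> (if i = n then UNIV else {..<\<zeta> (int i)})"
  have U: "open U" "v i \<in> U"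
    using i zeta_pred_less[of i] less_zeta[of i] unfolding U_def by auto
  have J: "joins (\<phi> i - 1) (l i) (r i) (v i)"
    using lr i unfolding spline_pieces_def by auto
  then show "poly ((pderiv ^^ j) (r i)) (v i) = poly ((pderiv ^^ j) (l i)) (v i)"
    using j unfolding joins_def by auto
  have "s x = poly (l i) x" if "x \<in> {v 0..v n} \<inter> U" "x \<le> v i" for x
  proof -
    have "x \<in> {\<zeta> (int i - 1)..v i}" using that zeta_first unfolding U_def by (cases "i = 0") auto
    then show ?thesis using lr i unfolding spline_pieces_def by auto
  qed
  moreover have "s x = poly (r i) x" if "x \<in> {v 0..v n} \<inter> U" "v i \<le> x" for x
  proof -
    have "x \<in> {v i..\<zeta> (int i)}" using that zeta_last unfolding U_def by (cases "i = n") auto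
    then show ?thesis using lr i unfolding spline_pieces_def by auto
  qed
  ultimately have "D j s (v i) =
      (if v i \<le> v i then poly ((pderiv ^^ j) (l i)) (v i) else poly ((pderiv ^^ j) (r i)) (v i))"
    using U v_bounds[OF i] v_first_less_last J j
    by (intro nth_deriv_on_piecewise_poly[where U = U and m = "\<phi> i - 1" and v = "v i"]) auto
  then show "D j s (v i) = poly ((pderiv ^^ j) (l i)) (v i)" by simp
qed

lemma spline_pieces_add_scaled:
  assumes "spline_pieces l r s" "spline_pieces l' r' s'"
  shows "spline_pieces (\<lambda>i. l i + smult c (l' i)) (\<lambda>i. r i + smult c (r' i)) (\<lambda>x. s x + c * s' x)"
proof -
  have "joins k (p + smult c p') (q + smult c q') x"
    if "joins k p q x" "joins k p' q' x" for k p q p' q' x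
    using that by (auto simp: joins_def higher_pderiv_add higher_pderiv_smult)
  moreover have "degree (p + smult c q) \<le> k" if "degree p \<le> k" "degree q \<le> k" for p q k
    using that by (intro degree_add_le) (auto intro: order.trans[OF degree_smult_le])
  ultimately show ?thesis
    using assms unfolding spline_pieces_def by auto
qed

lemma spline_add_scaled:
  assumes "is_spline s" "is_spline s'"
  shows "is_spline (\<lambda>x. s x + c * s' x)"
    and "\<And>i j. i \<le> n \<Longrightarrow> j \<le> \<phi> i - 1 \<Longrightarrow>
      D j (\<lambda>x. s x + c * s' x) (v i) = D j s (v i) + c * D j s' (v i)"
proof -
  obtain l r l' r' where *: "spline_pieces l r s" "spline_pieces l' r' s'"
    using assms unfolding is_spline_def by blast
  note ** = spline_pieces_add_scaled[OF *, of c]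
  then show "is_spline (\<lambda>x. s x + c * s' x)" unfolding is_spline_def by blast
  show "D j (\<lambda>x. s x + c * s' x) (v i) = D j s (v i) + c * D j s' (v i)"
    if "i \<le> n" "j \<le> \<phi> i - 1" for i j
    using that by (simp add: spline_pieces_deriv(1)[OF **] spline_pieces_deriv(1)[OF *(1)]
        spline_pieces_deriv(1)[OF *(2)] higher_pderiv_add higher_pderiv_smult)
qed

lemma spline_pieces_poly:
  "(\<And>i. i \<le> n \<Longrightarrow> degree p \<le> \<phi> i) \<Longrightarrow> spline_pieces (\<lambda>_. p) (\<lambda>_. p) (poly p)"
  by (auto simp: spline_pieces_def joins_def)

lemma spline_sum:
  assumes "finite K" "\<And>k. k \<in> K \<Longrightarrow> is_spline (s k)"
  shows "is_spline (\<lambda>x. \<Sum>k\<in>K. c k * s k x) \<and>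
    (\<forall>i\<le>n. \<forall>j\<le>\<phi> i - 1. D j (\<lambda>x. \<Sum>k\<in>K. c k * s k x) (v i) = (\<Sum>k\<in>K. c k * D j (s k) (v i)))"
  using assms
proof (induction K)
  case empty
  have "poly 0 = (\<lambda>x. 0 :: real)" by auto
  then have "spline_pieces (\<lambda>_. 0) (\<lambda>_. 0) (\<lambda>x. 0)" using spline_pieces_poly[of 0] by simp
  note P = this
  have "is_spline (\<lambda>x. 0)" unfolding is_spline_def using P by blast
  moreover have "D j (\<lambda>x. 0) (v i) = 0" if "i \<le> n" "j \<le> \<phi> i - 1" for i j
    using spline_pieces_deriv(1)[OF P that] by simp
  ultimately show ?case by simp
next
  case (insert k K)
  then have eq: "(\<lambda>x. \<Sum>k\<in>insert k K. c k * s k x) = (\<lambda>x. (\<Sum>k\<in>K. c k * s k x) + c k * s k x)"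
    by (simp add: add.commute)
  have IH: "is_spline (\<lambda>x. \<Sum>k\<in>K. c k * s k x)"
    "\<And>i j. i \<le> n \<Longrightarrow> j \<le> \<phi> i - 1 \<Longrightarrow>
      D j (\<lambda>x. \<Sum>k\<in>K. c k * s k x) (v i) = (\<Sum>k\<in>K. c k * D j (s k) (v i))"
    and "is_spline (s k)"
    using insert by auto
  note lin = spline_add_scaled[OF this(1,3), where c = "c k"]
  show ?case
    unfolding eq unfolding sum.insert[OF insert.hyps]
  proof (intro conjI allI impI)
    fix i j assume ij: "i \<le> n" "j \<le> \<phi> i - 1"
    show "D j (\<lambda>x. (\<Sum>k\<in>K. c k * s k x) + c k * s k x) (v i) =
        c k * D j (s k) (v i) + (\<Sum>k\<in>K. c k * D j (s k) (v i))"
      unfolding lin(2)[OF ij] IH(2)[OF ij] by (rule add.commute)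
  qed (rule lin(1))
qed

text \<open>The problem decouples: contact at \<open>\<zeta> (int i)\<close> involves only
  \<open>r i\<close> and \<open>l (Suc i)\<close>, each with one coefficient left.\<close>

lemma spline_eq_0:
  assumes "is_spline s" and D0: "\<And>i j. i \<le> n \<Longrightarrow> j \<le> \<phi> i - 1 \<Longrightarrow> D j s (v i) = 0"
    and "x \<in> {v 0..v n}"
  shows "s x = 0"
proof -
  obtain l r where lr: "spline_pieces l r s" using assms unfolding is_spline_def by blast
  have z: "poly ((pderiv ^^ j) (l i)) (v i) = 0" "poly ((pderiv ^^ j) (r i)) (v i) = 0"
    if "i \<le> n" "j < \<phi> i" for i j
    using D0[of i j] spline_pieces_deriv[OF lr, of i j] that by auto
  have 0: "r i = 0 \<and> l (Suc i) = 0" if i: "i < n" for i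
  proof -
    obtain c where c: "r i = smult c ([:- v i, 1:] ^ \<phi> i)"
      by (rule poly_eq_monom_of_higher_pderiv_eq_0[of "r i" "\<phi> i" "v i"])
        (use lr z i in \<open>auto simp: spline_pieces_def\<close>)
    obtain d where d: "l (Suc i) = smult d ([:- v (Suc i), 1:] ^ \<phi> (Suc i))"
      by (rule poly_eq_monom_of_higher_pderiv_eq_0[of "l (Suc i)" "\<phi> (Suc i)" "v (Suc i)"])
        (use lr z i in \<open>auto simp: spline_pieces_def\<close>)
    have "joins 1 (r i) (l (Suc i)) (\<zeta> (int i))"
      using lr i unfolding spline_pieces_def by auto
    then have "c = 0 \<and> d = 0"
      unfolding c d using zeta_mem[OF i] phi_ge[of i] phi_ge[of "Suc i"] i
      by (intro joins_1_unique) auto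
    then show ?thesis using c d by simp
  qed
  obtain i where i: "i \<le> n" "x \<in> {\<zeta> (int i - 1)..\<zeta> (int i)}"
    using ex_zeta_interval[OF assms(3)] by blast
  have s: "x \<le> v i \<Longrightarrow> s x = poly (l i) x" "v i \<le> x \<Longrightarrow> s x = poly (r i) x"
    using lr i unfolding spline_pieces_def by auto
  \<comment> \<open>Only \<open>l 0\<close> and \<open>r n\<close> are not yet known to vanish. The
    first matters only at \<open>x = v 0\<close>, where \<open>r 0\<close> serves instead; the
    second is never reached, since no \<open>x\<close> exceeds \<open>v n\<close>.\<close>
  show ?thesis
  proof (cases "x \<le> v i")
    case True
    then show ?thesis
      using s 0[of "i - 1"] 0[of 0] i assms(3) n_pos by (cases i) auto
  next
    case False
    then show ?thesis
      using s 0[of i] i zeta_last by (cases "i = n") auto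
  qed
qed

lemma spline_eqI:
  assumes "is_spline s" "is_spline s'"
    and D: "\<And>i j. i \<le> n \<Longrightarrow> j \<le> \<phi> i - 1 \<Longrightarrow> D j s (v i) = D j s' (v i)"
    and "x \<in> {v 0..v n}"
  shows "s x = s' x"
proof -
  note lin = spline_add_scaled[OF assms(1,2), where c = "-1"]
  have "s x + (-1) * s' x = 0"
  proof (rule spline_eq_0[OF lin(1) _ assms(4)])
    fix i j assume "i \<le> n" "j \<le> \<phi> i - 1"
    from lin(2)[OF this] D[OF this]
    show "D j (\<lambda>x. s x + (-1) * s' x) (v i) = 0" by (simp only:)
  qed
  then show ?thesis by simp
qed

text \<open>The data at a knot leave one free coefficient on each side of it. In every gap the two
  free coefficients are found from the two contact conditions, independently of the other
  gaps.\<close>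

lemma ex_spline:
  fixes c :: "nat \<Rightarrow> nat \<Rightarrow> real"
  shows "\<exists>s. is_spline s \<and> (\<forall>i\<le>n. \<forall>j\<le>\<phi> i - 1. D j s (v i) = c i j)"
proof -
  have "\<forall>i. \<exists>p. degree p \<le> \<phi> i - 1 \<and> (\<forall>j\<le>\<phi> i - 1. poly ((pderiv ^^ j) p) (v i) = c i j)"
    using ex_poly_higher_pderiv by blast
  then obtain T where T: "\<And>i. degree (T i) \<le> \<phi> i - 1"
    "\<And>i j. j \<le> \<phi> i - 1 \<Longrightarrow> poly ((pderiv ^^ j) (T i)) (v i) = c i j"
    by metis
  define Q where "Q i e = T i + smult e ([:- v i, 1:] ^ \<phi> i)" for i e
  have "\<exists>e. i < n \<longrightarrow> joins 1 (Q i (fst e)) (Q (Suc i) (snd e)) (\<zeta> (int i))" for i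
  proof (cases "i < n")
    case True
    then show ?thesis
      using ex_joins_1[of "v i" "\<zeta> (int i)" "v (Suc i)" "\<phi> i" "\<phi> (Suc i)" "T i" "T (Suc i)"]
        zeta_mem[of i] phi_ge[of i] phi_ge[of "Suc i"] by (auto simp: Q_def)
  qed simp
  \<comment> \<open>In gap \<open>i\<close>, \<open>fst (e i)\<close> belongs to the right piece at
    \<open>v i\<close> and \<open>snd (e i)\<close> to the left piece at
    \<open>v (Suc i)\<close>.\<close>
  then obtain e where e: "\<And>i. i < n \<Longrightarrow> joins 1 (Q i (fst (e i))) (Q (Suc i) (snd (e i))) (\<zeta> (int i))"
    by metis
  have degQ: "degree (Q i d) \<le> \<phi> i" for i d
  proof -
    have "degree ([:- v i, 1:] ^ \<phi> i) \<le> \<phi> i"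
      using degree_power_le[of "[:- v i, 1:]" "\<phi> i"] by simp
    then show ?thesis
      unfolding Q_def using T(1)[of i]
      by (intro degree_add_le) (auto intro: order.trans[OF degree_smult_le])
  qed
  have DQ: "poly ((pderiv ^^ j) (Q i d)) (v i) = c i j" if "i \<le> n" "j \<le> \<phi> i - 1" for i j d
    using that T(2) phi_ge[of i]
    by (simp add: Q_def higher_pderiv_add higher_pderiv_smult poly_higher_pderiv_linear_power_eq_0)
  \<comment> \<open>At the two end knots the degenerate side repeats the genuine one.\<close>
  define r where "r i = (if i < n then Q i (fst (e i)) else Q i (snd (e (i - 1))))" for i
  define l where "l i = (if i = 0 then Q i (fst (e i)) else Q i (snd (e (i - 1))))" for i
  have j1: "joins 1 (r i) (l (Suc i)) (\<zeta> (int i))" if "i < n" for i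
    using e[OF that] that by (simp add: r_def l_def)
  have DL: "poly ((pderiv ^^ j) (l i)) (v i) = c i j" "poly ((pderiv ^^ j) (r i)) (v i) = c i j"
    if "i \<le> n" "j \<le> \<phi> i - 1" for i j
    using DQ[OF that] by (auto simp: l_def r_def)
  define s where "s x = (let i = LEAST i. x \<le> \<zeta> (int i) in
    if x \<le> v i then poly (l i) x else poly (r i) x)" for x
  have s: "s x = (if x \<le> v i then poly (l i) x else poly (r i) x)"
    if "i \<le> n" "\<zeta> (int i - 1) < x" "x \<le> \<zeta> (int i)" for x i
    unfolding s_def Let_def Least_zeta_eq[OF that] ..
  have lrv: "poly (l i) (v i) = poly (r i) (v i)" if "i \<le> n" for i
    using DL[of i 0] that by simp
  \<comment> \<open>The point \<open>v 0\<close> equals \<open>\<zeta> (- 1)\<close> and lies in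
    none of the half-open cells.\<close>
  have s0: "s (v 0) = poly (l 0) (v 0)"
  proof -
    have "(LEAST i. v 0 \<le> \<zeta> (int i)) = 0" by (rule Least_eq_0) (use le_zeta[of 0] in auto)
    then show ?thesis by (simp add: s_def)
  qed
  have "spline_pieces l r s"
    unfolding spline_pieces_def
  proof (intro conjI allI impI ballI)
    fix i assume i: "i \<le> n"
    show "degree (l i) \<le> \<phi> i" "degree (r i) \<le> \<phi> i" using degQ by (auto simp: l_def r_def)
    show "joins (\<phi> i - 1) (l i) (r i) (v i)" unfolding joins_def using DL i by auto
    show "s x = poly (l i) x" if x: "x \<in> {\<zeta> (int i - 1)..v i}" for x
    proof (cases "x = \<zeta> (int i - 1)")
      case False
      then show ?thesis using x s[of i x] i le_zeta[of i] by auto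
    next
      \<comment> \<open>For positive \<open>i\<close>, \<open>LEAST\<close> assigns this left end
        point to the preceding cell, and continuity at \<zeta> supplies the value of
        \<open>l i\<close>.\<close>
      case True
      show ?thesis
      proof (cases i)
        case 0
        then show ?thesis using s0 True zeta_first by simp
      next
        case (Suc k)
        then have "s x = poly (r k) x"
          using s[of k x] True i less_zeta[of k] zeta_pred_le[of k] by auto
        also have "\<dots> = poly (l i) x"
          using j1[of k] Suc True i unfolding joins_def by (auto dest!: spec[of _ 0])
        finally show ?thesis .
      qed
    qed
    show "s x = poly (r i) x" if x: "x \<in> {v i..\<zeta> (int i)}" for x
    proof (cases "x = v i")
      case False
      then show ?thesis using x s[of i x] i zeta_pred_le[of i] by auto
    next
      case True
      then show ?thesis
        using s[of i x] s0 lrv[OF i] i zeta_pred_less[of i] le_zeta[of i] by (cases "i = 0") auto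
    qed
  qed (use j1 in auto)
  note P = this
  have "is_spline s" unfolding is_spline_def using P by blast
  moreover have "D j s (v i) = c i j" if "i \<le> n" "j \<le> \<phi> i - 1" for i j
    using spline_pieces_deriv(1)[OF P that] DL(1)[OF that] by simp
  ultimately show ?thesis by blast
qed

lemma is_spline_cong:
  assumes "is_spline s" "\<And>x. x \<in> {v 0..v n} \<Longrightarrow> s x = s' x"
  shows "is_spline s'"
    and "\<And>i j. i \<le> n \<Longrightarrow> j \<le> \<phi> i - 1 \<Longrightarrow> D j s (v i) = D j s' (v i)"
proof -
  obtain l r where lr: "spline_pieces l r s" using assms(1) unfolding is_spline_def by blast
  note lr' = spline_pieces_cong[OF lr assms(2)]
  show "is_spline s'" using lr' unfolding is_spline_def by blast
  show "D j s (v i) = D j s' (v i)" if "i \<le> n" "j \<le> \<phi> i - 1" for i j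
    using spline_pieces_deriv(1)[OF lr that] spline_pieces_deriv(1)[OF lr' that] by simp
qed

text \<open>Interpolation determines a spline on the interval, and restriction fixes it elsewhere.
  This justifies the definite description in \<open>bspline_like\<close>.\<close>

lemma ex1_spline_space:
  fixes c :: "nat \<Rightarrow> nat \<Rightarrow> real"
  shows "\<exists>!s. s \<in> spline_space n v \<zeta> \<phi> \<and> (\<forall>i\<le>n. \<forall>j\<le>\<phi> i - 1. D j s (v i) = c i j)"
proof -
  obtain s where s: "is_spline s" "\<forall>i\<le>n. \<forall>j\<le>\<phi> i - 1. D j s (v i) = c i j"
    using ex_spline[of c] by blast
  let ?s = "restrict s {v 0..v n}"
  have s': "is_spline ?s" "\<forall>i\<le>n. \<forall>j\<le>\<phi> i - 1. D j ?s (v i) = c i j"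
  proof -
    have eq: "s x = ?s x" if "x \<in> {v 0..v n}" for x using that by simp
    show "is_spline ?s" by (rule is_spline_cong(1)[OF s(1) eq])
    show "\<forall>i\<le>n. \<forall>j\<le>\<phi> i - 1. D j ?s (v i) = c i j"
      using is_spline_cong(2)[OF s(1) eq] s(2) by metis
  qed
  show ?thesis
  proof (rule ex1I[of _ ?s])
    fix u assume u: "u \<in> spline_space n v \<zeta> \<phi> \<and> (\<forall>i\<le>n. \<forall>j\<le>\<phi> i - 1. D j u (v i) = c i j)"
    show "u = ?s"
    proof (rule extensionalityI[of _ "{v 0..v n}"])
      fix x assume x: "x \<in> {v 0..v n}"
      have "is_spline u" using conjunct1[OF u] unfolding spline_space_iff by blast
      moreover have "D j u (v i) = D j ?s (v i)" if "i \<le> n" "j \<le> \<phi> i - 1" for i j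
        using u s'(2) that by metis
      ultimately show "u x = ?s x" using spline_eqI[OF _ s'(1) _ x] by blast
    next
      show "u \<in> extensional {v 0..v n}" using conjunct1[OF u] unfolding spline_space_iff by blast
    qed (rule restrict_extensional)
  next
    show "?s \<in> spline_space n v \<zeta> \<phi> \<and> (\<forall>i\<le>n. \<forall>j\<le>\<phi> i - 1. D j ?s (v i) = c i j)"
      unfolding spline_space_iff using s' by blast
  qed
qed

lemma bspline_like:
  assumes "i \<le> n"
  shows "is_spline (bspline_like n v \<zeta> \<phi> i \<alpha>)"
    and "\<And>k j. k \<le> n \<Longrightarrow> j \<le> \<phi> k - 1 \<Longrightarrow>
      D j (bspline_like n v \<zeta> \<phi> i \<alpha>) (v k) = (if k = i then gam v \<zeta> \<phi> i \<alpha> j else 0)"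
proof -
  let ?P = "\<lambda>s. s \<in> spline_space n v \<zeta> \<phi> \<and>
    (\<forall>k\<le>n. \<forall>j\<le>\<phi> k - 1. D j s (v k) = (if k = i then gam v \<zeta> \<phi> i \<alpha> j else 0))"
  have "bspline_like n v \<zeta> \<phi> i \<alpha> = (THE s. ?P s)"
  proof -
    \<comment> \<open>The conditions at \<open>i\<close> and at the other knots merge into one table
      of data, the form taken by the existence and uniqueness lemma.\<close>
    have "(\<forall>j\<le>m i. F i j = g j) \<and> (\<forall>k\<le>n. k \<noteq> i \<longrightarrow> (\<forall>j\<le>m k. F k j = 0)) \<longleftrightarrow>
        (\<forall>k\<le>n. \<forall>j\<le>m k. F k j = (if k = i then g j else 0))"
      for F :: "nat \<Rightarrow> nat \<Rightarrow> real" and m g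
      using assms by auto
    from this[of "\<lambda>k. \<phi> k - 1" "\<lambda>k j. D j _ (v k)"] show ?thesis
      unfolding bspline_like_def by (simp only:)
  qed
  moreover have "?P (THE s. ?P s)"
    by (rule theI'[OF ex1_spline_space])
  ultimately have "?P (bspline_like n v \<zeta> \<phi> i \<alpha>)" by simp
  then show "is_spline (bspline_like n v \<zeta> \<phi> i \<alpha>)"
    "\<And>k j. k \<le> n \<Longrightarrow> j \<le> \<phi> k - 1 \<Longrightarrow>
      D j (bspline_like n v \<zeta> \<phi> i \<alpha>) (v k) = (if k = i then gam v \<zeta> \<phi> i \<alpha> j else 0)"
    by (auto simp: spline_space_iff)
qed

end

section \<open>Reproduction of polynomials by the quasi-interpolant\<close>

theorem proposition10:
  fixes n :: nat and a b :: real
    and v :: "nat \<Rightarrow> real" and \<zeta> :: "int \<Rightarrow> real" and \<phi> :: "nat \<Rightarrow> nat"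
    and t :: "nat \<Rightarrow> nat \<times> nat \<Rightarrow> nat \<Rightarrow> real"
    and L :: "nat \<Rightarrow> nat \<times> nat \<Rightarrow> nat \<Rightarrow> real poly"
    and p :: "real poly"
  assumes "n \<ge> 1"
    and "v 0 = a" and "v n = b" and "\<And>i. i < n \<Longrightarrow> v i < v (i + 1)"
    and "\<And>i. i < n \<Longrightarrow> \<zeta> (int i) \<in> {v i<..<v (i + 1)}"
    and "\<zeta> (- 1) = v 0" and "\<zeta> (int n) = v n"
    and "\<And>i. i \<le> n \<Longrightarrow> \<phi> i \<ge> 2"
    and "\<And>i \<alpha> k. i \<le> n \<Longrightarrow> \<alpha> \<in> multi_indices (\<phi> i - 1) \<Longrightarrow> k \<le> \<phi> i \<Longrightarrow> t i \<alpha> k \<in> {a..b}"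
    and "\<And>i \<alpha>. i \<le> n \<Longrightarrow> \<alpha> \<in> multi_indices (\<phi> i - 1) \<Longrightarrow> inj_on (t i \<alpha>) {0..\<phi> i}"
    and "\<And>i \<alpha> j. i \<le> n \<Longrightarrow> \<alpha> \<in> multi_indices (\<phi> i - 1) \<Longrightarrow> j \<le> \<phi> i \<Longrightarrow>
           degree (L i \<alpha> j) \<le> \<phi> i"
    and "\<And>i \<alpha> j k. i \<le> n \<Longrightarrow> \<alpha> \<in> multi_indices (\<phi> i - 1) \<Longrightarrow> j \<le> \<phi> i \<Longrightarrow> k \<le> \<phi> i \<Longrightarrow>
           poly (L i \<alpha> j) (t i \<alpha> k) = (if j = k then 1 else 0)"
    and "degree p \<le> Min (\<phi> ` {0..n})"
  shows "\<forall>x\<in>{a..b}. quasi_interp n v \<zeta> \<phi> t L (poly p) x = poly p x"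
proof
  fix x assume x: "x \<in> {a..b}"
  interpret spline_knots n v \<zeta> \<phi>
    using assms(1,4-8) by unfold_locales auto
  have deg: "degree p \<le> \<phi> i" if "i \<le> n" for i
  proof -
    have "Min (\<phi> ` {0..n}) \<le> \<phi> i" using that by (intro Min_le) auto
    with assms(13) show ?thesis by linarith
  qed
  have nu: "nu v \<zeta> \<phi> t L i \<alpha> (poly p) =
      blossom (\<phi> i) p (v i # replicate (fst \<alpha>) (\<zeta> (int i - 1)) @ replicate (snd \<alpha>) (\<zeta> (int i)))"
    if i: "i \<le> n" and \<alpha>: "\<alpha> \<in> multi_indices (\<phi> i - 1)" for i \<alpha>
    unfolding nu_def
  proof (rule sum_blossom_lagrange[OF deg[OF i] assms(10)[OF i \<alpha>]])
    show "length (v i # replicate (fst \<alpha>) (\<zeta> (int i - 1)) @ replicate (snd \<alpha>) (\<zeta> (int i))) = \<phi> i"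
      using \<alpha> phi_ge[OF i] by (simp add: multi_indices_def)
  qed (use assms(11,12)[OF i \<alpha>] in auto)
  have fin: "finite (multi_indices k)" for k
    by (simp add: multi_indices_eq)
  define N where "N = bspline_like n v \<zeta> \<phi>"
  \<comment> \<open>The share of knot \<open>i\<close>, which turns out to have the Hermite data of
    \<open>p\<close> at \<open>v i\<close> and zero data at all other knots.\<close>
  define s where "s i = (\<lambda>x. \<Sum>\<alpha>\<in>multi_indices (\<phi> i - 1). nu v \<zeta> \<phi> t L i \<alpha> (poly p) * N i \<alpha> x)" for i
  have s: "is_spline (s i)" "D j (s i) (v k) = (if k = i then poly ((pderiv ^^ j) p) (v k) else 0)"
    if i: "i \<le> n" and k: "k \<le> n" "j \<le> \<phi> k - 1" for i k j
  proof -
    have N: "is_spline (N i \<alpha>)" "D j (N i \<alpha>) (v k) = (if k = i then gam v \<zeta> \<phi> i \<alpha> j else 0)" for \<alpha>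
      unfolding N_def using bspline_like[OF i] k by blast+
    note sum = spline_sum[OF fin[of "\<phi> i - 1"], of "N i" "\<lambda>\<alpha>. nu v \<zeta> \<phi> t L i \<alpha> (poly p)", folded s_def, OF N(1)]
    show "is_spline (s i)" using sum by blast
    have "D j (s i) (v k) = (\<Sum>\<alpha>\<in>multi_indices (\<phi> i - 1). nu v \<zeta> \<phi> t L i \<alpha> (poly p) * D j (N i \<alpha>) (v k))"
      using sum k by blast
    also have "\<dots> = (if k = i then poly ((pderiv ^^ j) p) (v k) else 0)"
    proof (cases "k = i")
      case True
      \<comment> \<open>\<open>theta \<phi> i\<close> serves as the contraction factor
        \<open>h\<close>, which makes the contracted interval the one in \<open>gam\<close>; it is
        nonzero because \<open>\<phi> i \<ge> 2\<close>.\<close>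
      have "\<phi> i > 0" "j < \<phi> i" "theta \<phi> i \<noteq> 0" "\<zeta> (int i - 1) \<noteq> \<zeta> (int i)"
        using phi_ge[OF i] k True zeta_pred_less_zeta[OF i] by (auto simp: theta_def)
      from sum_blossom_bernstein_deriv[OF deg[OF i] this(1,2,4,3), of "v i"] show ?thesis
        unfolding N(2) gam_def S_left_def S_right_def using True i by (simp add: nu cong: sum.cong)
    qed (simp add: N(2))
    finally show "D j (s i) (v k) = (if k = i then poly ((pderiv ^^ j) p) (v k) else 0)" .
  qed
  \<comment> \<open>The factor \<open>1\<close> gives the outer sum the shape of
    \<open>spline_sum\<close>.\<close>
  have Q: "quasi_interp n v \<zeta> \<phi> t L (poly p) = (\<lambda>x. \<Sum>i\<in>{0..n}. 1 * s i x)"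
    by (simp add: quasi_interp_def s_def N_def fun_eq_iff)
  have sum: "is_spline (\<lambda>x. \<Sum>i\<in>{0..n}. 1 * s i x) \<and> (\<forall>k\<le>n. \<forall>j\<le>\<phi> k - 1.
      D j (\<lambda>x. \<Sum>i\<in>{0..n}. 1 * s i x) (v k) = (\<Sum>i\<in>{0..n}. 1 * D j (s i) (v k)))"
    by (rule spline_sum) (use s(1) in auto)
  have P: "spline_pieces (\<lambda>_. p) (\<lambda>_. p) (poly p)"
    by (rule spline_pieces_poly[OF deg])
  show "quasi_interp n v \<zeta> \<phi> t L (poly p) x = poly p x"
    unfolding Q
  proof (rule spline_eqI[where s = "\<lambda>x. \<Sum>i\<in>{0..n}. 1 * s i x"])
    show "is_spline (poly p)" unfolding is_spline_def using P by blast
    fix k j assume k: "k \<le> n" "j \<le> \<phi> k - 1"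
    have "D j (\<lambda>x. \<Sum>i\<in>{0..n}. 1 * s i x) (v k) = (\<Sum>i\<in>{0..n}. 1 * D j (s i) (v k))"
      using sum k by blast
    also have "\<dots> = (\<Sum>i\<in>{0..n}. if k = i then poly ((pderiv ^^ j) p) (v k) else 0)"
      by (intro sum.cong refl) (use s(2) k in auto)
    also have "\<dots> = D j (poly p) (v k)"
      using k spline_pieces_deriv(1)[OF P k] by simp
    finally show "D j (\<lambda>x. \<Sum>i\<in>{0..n}. 1 * s i x) (v k) = D j (poly p) (v k)" .
  qed (use sum x assms(2,3) in auto)
qed

end
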